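(* Let $p$ denote the smooth density of $A_\infty=(A^1_\infty,\dots,A^d_\infty)$ with respect to Lebesgue measure on $\mathbb{R}^d$. Then $p$ satisfies, for $y\in(0,\infty)^d$, the partial differential equation $$\sum_{i,j=1}^d(\alpha_i,\alpha_j)\,y_iy_j\frac{\partial^2p}{\partial y_i\partial y_j}+\sum_{i=1}^d\left(\Big(\alpha_i(\mu)+\|\alpha_i\|^2+2\sum_{j=1}^d(\alpha_i,\alpha_j)\Big)y_i-\frac12\right)\frac{\partial p}{\partial y_i}=-\left(\sum_{i,j=1}^d(\alpha_i,\alpha_j)+\sum_{i=1}^d\alpha_i(\mu)\right)p .$$
   Context: Let $\alpha_1,\ldots,\alpha_d$ be distinct non-zero vectors in $\mathbb{R}^n$; write $\alpha_i(x)=(\alpha_i,x)$ with $(\cdot,\cdot)$ the usual inner product. Assume $\Omega=\{x\in\mathbb{R}^n:\alpha_i(x)>0\ \forall i\}$ is non-empty and let $\mu\in\Omega$. Let $B^{(\mu)}$ be a standard Brownian motion in $\mathbb{R}^n$ with drift $\mu$, started at $0$. For $i=1,\dots,d$ set $A_\infty^i=\int_0^\infty e^{-2\alpha_i(B_s^{(\mu)})}\,ds$ (finite almost surely). The random vector $A_\infty$ has a smooth density with respect to Lebesgue measure on $\mathbb{R}^d$. *)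

theory Defs
  imports "HOL-Probability.Probability"
begin

definition standard_brownian_motion ::
  "'w measure \<Rightarrow> (real \<Rightarrow> 'w \<Rightarrow> real ^ 'n) \<Rightarrow> bool" where
  "standard_brownian_motion M W \<longleftrightarrow>
     prob_space M \<and>
     (\<forall>t\<ge>0. W t \<in> borel_measurable M) \<and>
     (AE \<omega> in M. W 0 \<omega> = 0) \<and>
     (AE \<omega> in M. continuous_on {0..} (\<lambda>t. W t \<omega>)) \<and>
     (\<forall>(t :: nat \<Rightarrow> real) k. 0 \<le> t 0 \<and> incseq t \<longrightarrow>
        prob_space.indep_vars M (\<lambda>_. borel) (\<lambda>j \<omega>. W (t (Suc j)) \<omega> - W (t j) \<omega>) {..<k}) \<and>
     (\<forall>s t. 0 \<le> s \<and> s < t \<longrightarrow>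
        distributed M lborel (\<lambda>\<omega>. W t \<omega> - W s \<omega>)
          (\<lambda>x. ennreal (\<Prod>k\<in>UNIV. normal_density 0 (sqrt (t - s)) (x $ k))))"

definition brownian_motion_with_drift ::
  "'w measure \<Rightarrow> real ^ 'n \<Rightarrow> (real \<Rightarrow> 'w \<Rightarrow> real ^ 'n) \<Rightarrow> bool" where
  "brownian_motion_with_drift M \<mu> B \<longleftrightarrow>
     standard_brownian_motion M (\<lambda>t \<omega>. B t \<omega> - t *\<^sub>R \<mu>)"

definition Omega :: "('d \<Rightarrow> real ^ 'n) \<Rightarrow> (real ^ 'n) set" where
  "Omega \<alpha> = {x. \<forall>i. 0 < \<alpha> i \<bullet> x}"

(* The Lebesgue integral is 0 by convention if it diverges. For a drift in Omega \<alpha> this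
   happens only on a null set. *)
definition A_infinity ::
  "('d \<Rightarrow> real ^ 'n) \<Rightarrow> (real \<Rightarrow> 'w \<Rightarrow> real ^ 'n) \<Rightarrow> 'w \<Rightarrow> real ^ 'd" where
  "A_infinity \<alpha> B \<omega> = (\<chi> i. LINT s:{0..}|lborel. exp (- 2 * (\<alpha> i \<bullet> B s \<omega>)))"

definition partial :: "'d \<Rightarrow> (real ^ 'd \<Rightarrow> real) \<Rightarrow> real ^ 'd \<Rightarrow> real" where
  "partial i f y = deriv (\<lambda>h. f (y + h *\<^sub>R axis i 1)) 0"

primrec C_k :: "nat \<Rightarrow> (real ^ 'd \<Rightarrow> real) \<Rightarrow> bool" where
  "C_k 0 f \<longleftrightarrow> continuous_on UNIV f"
| "C_k (Suc k) f \<longleftrightarrow> (\<forall>y. f differentiable (at y)) \<and> (\<forall>i. C_k k (partial i f))"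

definition smooth :: "(real ^ 'd \<Rightarrow> real) \<Rightarrow> bool" where
  "smooth f \<longleftrightarrow> (\<forall>k. C_k k f)"

(* Nonnegativity is stated separately because ennreal truncates negative values to 0. *)
definition smooth_density ::
  "'w measure \<Rightarrow> ('w \<Rightarrow> real ^ 'd) \<Rightarrow> (real ^ 'd \<Rightarrow> real) \<Rightarrow> bool" where
  "smooth_density M X p \<longleftrightarrow>
     smooth p \<and> (\<forall>y. 0 \<le> p y) \<and> distributed M lborel X (\<lambda>y. ennreal (p y))"

end

theory Submission imports Defs begin

text \<open>
  The equation is the stationarity equation of a renewal identity. Cutting the path at a time
  \<open>t > 0\<close> gives
  \<open>A\<^sub>i = (integral of exp (- 2 \<alpha>\<^sub>i(B\<^sub>s)) over [0, t]) + exp (- 2 \<alpha>\<^sub>i(B\<^sub>t)) * A'\<^sub>i\<close>,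
  where \<open>A'\<close> is the same functional of the restarted path; it is independent of \<open>B\<^sub>t\<close> and has the
  law of \<open>A\<close>. As \<open>t\<close> tends to 0 the first summand is \<open>t + o(t)\<close> in \<open>L\<^sup>1\<close>, so for a bounded Lipschitz
  function \<open>f\<close> the expectations of \<open>f(A)\<close> and of \<open>f(t + exp (- 2 \<alpha>(B\<^sub>t)) A')\<close> differ by
  \<open>o(t)\<close> (\<open>short_time_estimate\<close>).

  In the second expectation the density of \<open>A'\<close> is \<open>p\<close>. If \<open>f\<close> has compact support, the affine change
  of variables \<open>z = t + exp (- 2 \<alpha>(B\<^sub>t)) y\<close> moves all dependence on \<open>t\<close> and \<open>B\<^sub>t\<close> from \<open>f\<close>
  to \<open>p\<close> (\<open>perturbed_density_change_of_variables\<close>), which is smooth; \<open>f\<close> need not be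
  differentiated, and no integration by parts occurs. With \<open>t = s\<^sup>2\<close> and \<open>B\<^sub>t = s g + s\<^sup>2 \<mu>\<close>, \<open>g\<close>
  standard Gaussian, the transported density is a function of \<open>s\<close> with a second-order Taylor
  expansion. Its linear term is linear in \<open>g\<close> and averages to 0; its quadratic term averages, since
  \<open>E (\<alpha>\<^sub>i \<bullet> g)(\<alpha>\<^sub>j \<bullet> g) = \<alpha>\<^sub>i \<bullet> \<alpha>\<^sub>j\<close>, to twice the difference of the two sides of the
  differential equation (\<open>gaussian_average_limit\<close>).

  Comparing both expansions, this difference is orthogonal to every compactly supported Lipschitz
  function, hence to all cone-shaped bumps, and being continuous it vanishes
  (\<open>adjoint_generator_orthogonal\<close>, \<open>adjoint_generator_zero\<close>).

  Almost sure convergence of the integrals follows from the existence of the density: a divergent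
  integral has the value 0, and a random vector with a density avoids coordinate hyperplanes almost
  surely (\<open>AE_convergent\<close>). Equality in law and independence for the restarted functional are
  obtained for Riemann sums, which depend on finitely many increments, and pass to the limit
  (\<open>renewed_riemann_sum\<close>, \<open>renewed_limit\<close>).
\<close>

section \<open>Lebesgue measure on coordinate space\<close>

lemma Basis_vec_eq_range: "(Basis :: (real ^ 'n::finite) set) = range (\<lambda>i. axis i 1)"
  by (auto simp: Basis_vec_def)

lemma inj_axis_one: "inj (\<lambda>i::'n::finite. axis i (1::real))"
  by (auto simp: inj_def axis_eq_axis)

lemma sum_Basis_vec: "(\<Sum>b\<in>(Basis :: (real ^ 'n::finite) set). F b) = (\<Sum>i\<in>UNIV. F (axis i 1))"
  by (simp add: Basis_vec_eq_range sum.reindex[OF inj_axis_one])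

lemma prod_Basis_vec: "(\<Prod>b\<in>(Basis :: (real ^ 'n::finite) set). F b) = (\<Prod>i\<in>UNIV. F (axis i 1))"
  by (simp add: Basis_vec_eq_range prod.reindex[OF inj_axis_one])

lemma sum_axis_nth: "(\<Sum>i\<in>UNIV. F i * axis i 1 $ k) = (F k :: real)"
  by (simp add: axis_def if_distrib[of "\<lambda>z. _ * z"] cong: if_cong)

lemma lborel_vec_diagonal:
  fixes \<kappa> c :: "real ^ 'd::finite"
  assumes \<kappa>: "\<And>i. 0 < \<kappa> $ i"
  shows "(lborel :: (real ^ 'd) measure) =
    density (distr lborel borel (\<lambda>x. \<chi> i. c $ i + \<kappa> $ i * x $ i)) (\<lambda>_. ennreal (\<Prod>i\<in>UNIV. \<kappa> $ i))"
proof -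
  have T: "(\<lambda>x::real^'d. c + (\<Sum>j\<in>Basis. (\<kappa> \<bullet> j * (x \<bullet> j)) *\<^sub>R j)) = (\<lambda>x. \<chi> i. c $ i + \<kappa> $ i * x $ i)"
    by (simp add: fun_eq_iff vec_eq_iff sum_Basis_vec inner_axis sum_axis_nth)
  have P: "(\<Prod>j\<in>(Basis::(real^'d) set). \<bar>\<kappa> \<bullet> j\<bar>) = (\<Prod>i\<in>UNIV. \<kappa> $ i)"
    using \<kappa> by (simp add: prod_Basis_vec inner_axis less_imp_le)
  have nz: "\<kappa> \<bullet> j \<noteq> 0" if "j \<in> Basis" for j :: "real^'d"
    using that \<kappa> by (auto simp: Basis_vec_eq_range inner_axis) (metis less_irrefl)
  show ?thesis
    using lborel_affine_euclidean[where c="\<lambda>j. \<kappa> \<bullet> j" and t=c, OF nz]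
    unfolding T P .
qed

lemma lborel_integral_diagonal:
  fixes \<kappa> c :: "real ^ 'd::finite" and h :: "real ^ 'd \<Rightarrow> real"
  assumes \<kappa>: "\<And>i. 0 < \<kappa> $ i" and h[measurable]: "h \<in> borel_measurable borel"
  shows "integral\<^sup>L lborel h = (\<Prod>i\<in>UNIV. \<kappa> $ i) * (\<integral>x. h (\<chi> i. c $ i + \<kappa> $ i * x $ i) \<partial>lborel)"
proof -
  let ?T = "\<lambda>x::real^'d. \<chi> i. c $ i + \<kappa> $ i * x $ i"
  have pos: "0 < (\<Prod>i\<in>UNIV. \<kappa> $ i)" using \<kappa> by (intro prod_pos) auto
  have [measurable]: "?T \<in> borel_measurable borel"
    by (intro borel_measurable_continuous_onI continuous_intros)
  show ?thesis
    apply (subst lborel_vec_diagonal[OF \<kappa>, of c])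
    apply (subst integral_density)
    using pos by (auto simp: integral_distr)
qed

text \<open>Lebesgue measure on \<open>real ^ 'n\<close> is an image of the product measure indexed by the basis, so
  Fubini applies once basis vectors are identified with coordinates.\<close>

lemma has_bochner_integral_lborel_vec_prod:
  fixes h :: "'n::finite \<Rightarrow> real \<Rightarrow> real"
  assumes h: "\<And>k. has_bochner_integral lborel (h k) (r k)"
  shows "has_bochner_integral (lborel :: (real ^ 'n) measure) (\<lambda>x. \<Prod>k\<in>UNIV. h k (x $ k)) (\<Prod>k\<in>UNIV. r k)"
proof -
  interpret P: product_sigma_finite "\<lambda>b::real^'n. lborel :: real measure" ..
  define ix where "ix = the_inv (\<lambda>i::'n. axis i (1::real))"
  have ix[simp]: "ix (axis i 1) = i" for i
    unfolding ix_def by (rule the_inv_f_f[OF inj_axis_one])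
  have hm[measurable]: "h k \<in> borel_measurable borel" for k
    using h[of k] by (auto simp: has_bochner_integral_iff)
  have int: "integrable (Pi\<^sub>M Basis (\<lambda>b. lborel)) (\<lambda>x. \<Prod>b\<in>(Basis::(real^'n) set). h (ix b) (x b))"
    using h by (intro P.product_integrable_prod) (auto simp: has_bochner_integral_iff)
  have val: "(\<integral>x. (\<Prod>b\<in>(Basis::(real^'n) set). h (ix b) (x b)) \<partial>Pi\<^sub>M Basis (\<lambda>b. lborel)) = (\<Prod>k\<in>UNIV. r k)"
    using h by (subst P.product_integral_prod)
      (auto simp: has_bochner_integral_iff prod_Basis_vec)
  have eq: "(\<Prod>k\<in>UNIV. h k (\<Sum>b\<in>(Basis::(real^'n) set). f b * b $ k)) = (\<Prod>b\<in>Basis. h (ix b) (f b))" for f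
    by (simp add: prod_Basis_vec sum_Basis_vec sum_axis_nth)
  have [measurable]: "(\<lambda>f. \<Sum>b\<in>(Basis::(real^'n) set). f b *\<^sub>R b) \<in> Pi\<^sub>M Basis (\<lambda>b. lborel) \<rightarrow>\<^sub>M borel"
    by measurable
  have [measurable]: "(\<lambda>x::real^'n. \<Prod>k\<in>UNIV. h k (x $ k)) \<in> borel_measurable borel"
    by measurable
  show ?thesis
    unfolding has_bochner_integral_iff using int val
    by (subst (1 2) lborel_eq) (auto simp: integrable_distr_eq integral_distr eq)
qed

lemma borel_measurable_vec_lambda:
  fixes f :: "'a \<Rightarrow> 'd::finite \<Rightarrow> real"
  assumes "\<And>i. (\<lambda>x. f x i) \<in> borel_measurable M"
  shows "(\<lambda>x. \<chi> i. f x i) \<in> borel_measurable M"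
  unfolding borel_measurable_euclidean_space[where f="\<lambda>x. \<chi> i. f x i"]
  using assms by (auto simp: Basis_vec_eq_range inner_axis)

section \<open>Standard Gaussian densities\<close>

definition gauss :: "real \<Rightarrow> real ^ 'n \<Rightarrow> real" where
  "gauss t x = (\<Prod>k\<in>UNIV. normal_density 0 (sqrt t) (x $ k))"

lemma gauss_nonneg[simp]: "0 \<le> gauss t x"
  by (simp add: gauss_def prod_nonneg)

lemma gauss_measurable[measurable]: "gauss t \<in> borel_measurable borel"
  unfolding gauss_def by measurable

lemma has_bochner_integral_gauss:
  assumes "0 < t"
  shows "has_bochner_integral lborel (gauss t :: real ^ 'n::finite \<Rightarrow> real) 1"
proof -
  have "has_bochner_integral lborel (normal_density 0 (sqrt t)) 1"
    using assms by (simp add: has_bochner_integral_iff)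
  from has_bochner_integral_lborel_vec_prod[of "\<lambda>_::'n. normal_density 0 (sqrt t)", OF this]
  show ?thesis by (simp add: gauss_def[abs_def])
qed

text \<open>Completing the square: the exponential factor shifts the mean to \<open>t * c\<close>.\<close>

lemma has_bochner_integral_normal_exp:
  assumes "0 < t"
  shows "has_bochner_integral lborel (\<lambda>x. normal_density 0 (sqrt t) x * exp (c * x)) (exp (t * c\<^sup>2 / 2))"
proof -
  have eq: "normal_density 0 (sqrt t) x * exp (c * x) = normal_density (t * c) (sqrt t) x * exp (t * c\<^sup>2 / 2)" for x
  proof -
    have "- x\<^sup>2 / (2 * t) + c * x = - (x - t * c)\<^sup>2 / (2 * t) + t * c\<^sup>2 / 2"
      using assms by (simp add: field_simps power2_eq_square)
    then show ?thesis using assms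
      by (simp add: normal_density_def flip: exp_add)
  qed
  have "has_bochner_integral lborel (\<lambda>x. normal_density (t * c) (sqrt t) x) 1"
    using assms by (simp add: has_bochner_integral_iff)
  from has_bochner_integral_mult_left[of "exp (t * c\<^sup>2 / 2)", OF this] show ?thesis
    by (simp add: eq)
qed

lemma has_bochner_integral_gauss_exp:
  fixes c :: "real ^ 'n::finite"
  assumes "0 < t"
  shows "has_bochner_integral lborel (\<lambda>x. gauss t x * exp (c \<bullet> x)) (exp (t * (c \<bullet> c) / 2))"
proof -
  have "has_bochner_integral lborel (\<lambda>x::real^'n. \<Prod>k\<in>UNIV. normal_density 0 (sqrt t) (x $ k) * exp (c $ k * x $ k))
    (\<Prod>k\<in>UNIV. exp (t * (c $ k)\<^sup>2 / 2))"
    by (rule has_bochner_integral_lborel_vec_prod[OF has_bochner_integral_normal_exp[OF assms]])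
  also have "(\<Prod>k\<in>UNIV. exp (t * (c $ k)\<^sup>2 / 2)) = exp (t * (c \<bullet> c) / 2)"
    by (simp add: exp_sum inner_vec_def power2_eq_square sum_distrib_left flip: sum_divide_distrib exp_sum)
  also have "(\<lambda>x::real^'n. \<Prod>k\<in>UNIV. normal_density 0 (sqrt t) (x $ k) * exp (c $ k * x $ k))
      = (\<lambda>x. gauss t x * exp (c \<bullet> x))"
    by (simp add: fun_eq_iff gauss_def prod.distrib inner_vec_def exp_sum)
  finally show ?thesis .
qed

lemma has_bochner_integral_std_normal:
  "has_bochner_integral lborel (\<lambda>x. std_normal_density x * x ^ 0) 1"
  "has_bochner_integral lborel (\<lambda>x. std_normal_density x * x ^ 1) 0"
  "has_bochner_integral lborel (\<lambda>x. std_normal_density x * x ^ 2) 1"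
  using std_normal_moment_even[of 0] std_normal_moment_even[of 1] std_normal_moment_odd[of 0]
  by (auto simp: fact_numeral)

lemma has_bochner_integral_gauss_coord:
  "has_bochner_integral lborel (\<lambda>x::real^'n::finite. gauss 1 x * x $ k) 0"
proof -
  define e where "e i = (if i = k then 1 else 0 :: nat)" for i
  define r where "r i = (if i = k then 0 else 1 :: real)" for i
  have "has_bochner_integral lborel (\<lambda>x. std_normal_density x * x ^ e i) (r i)" for i
    using has_bochner_integral_std_normal by (simp add: e_def r_def)
  from has_bochner_integral_lborel_vec_prod[OF this]
  have "has_bochner_integral lborel (\<lambda>x::real^'n. \<Prod>i\<in>UNIV. std_normal_density (x $ i) * (x $ i) ^ e i) (\<Prod>i\<in>UNIV. r i)" .
  moreover have "(\<Prod>i\<in>UNIV. r i) = 0" by (auto simp: r_def)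
  moreover have "(\<Prod>i\<in>UNIV. (x $ i) ^ e i) = x $ k" for x :: "real^'n"
    by (simp add: e_def if_distrib[of "\<lambda>z. _ ^ z"] cong: if_cong)
  ultimately show ?thesis by (simp add: gauss_def prod.distrib)
qed

text \<open>The integrand factorizes over the coordinates; the exponent \<open>e i\<close> counts how often coordinate
  \<open>i\<close> occurs among \<open>k\<close> and \<open>l\<close>, so the diagonal case is a second moment and the off-diagonal
  case a product of two first moments.\<close>

lemma has_bochner_integral_gauss_coord2:
  "has_bochner_integral lborel (\<lambda>x::real^'n::finite. gauss 1 x * (x $ k * x $ l)) (if k = l then 1 else 0)"
proof -
  define e where "e i = (if i = k then 1 else 0) + (if i = l then 1 else 0 :: nat)" for i
  define r where "r i = (if i = k \<and> k \<noteq> l then 0 else if i = l \<and> k \<noteq> l then 0 else 1 :: real)" for i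
  have "has_bochner_integral lborel (\<lambda>x. std_normal_density x * x ^ e i) (r i)" for i
    using has_bochner_integral_std_normal by (auto simp: e_def r_def numeral_2_eq_2)
  from has_bochner_integral_lborel_vec_prod[OF this]
  have "has_bochner_integral lborel (\<lambda>x::real^'n. \<Prod>i\<in>UNIV. std_normal_density (x $ i) * (x $ i) ^ e i) (\<Prod>i\<in>UNIV. r i)" .
  moreover have "(\<Prod>i\<in>UNIV. r i) = (if k = l then 1 else 0)"
    by (cases "k = l") (auto simp: r_def)
  moreover have "(\<Prod>i\<in>UNIV. (x $ i) ^ e i) = x $ k * x $ l" for x :: "real^'n"
    by (simp add: e_def power_add prod.distrib if_distrib[of "\<lambda>z. _ ^ z"] cong: if_cong)
  ultimately show ?thesis by (simp add: gauss_def prod.distrib)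
qed

lemma has_bochner_integral_gauss_inner:
  fixes a :: "real ^ 'n::finite"
  shows "has_bochner_integral lborel (\<lambda>x. gauss 1 x * (a \<bullet> x)) 0"
proof -
  have "has_bochner_integral lborel (\<lambda>x::real^'n. \<Sum>k\<in>UNIV. a $ k * (gauss 1 x * x $ k)) (\<Sum>k\<in>UNIV. a $ k * 0)"
    by (intro has_bochner_integral_sum has_bochner_integral_mult_right has_bochner_integral_gauss_coord)
  then show ?thesis
    by (simp add: inner_vec_def sum_distrib_left mult_ac)
qed

lemma has_bochner_integral_gauss_inner2:
  fixes a b :: "real ^ 'n::finite"
  shows "has_bochner_integral lborel (\<lambda>x. gauss 1 x * ((a \<bullet> x) * (b \<bullet> x))) (a \<bullet> b)"
proof -
  have "has_bochner_integral lborel (\<lambda>x::real^'n. \<Sum>k\<in>UNIV. \<Sum>l\<in>UNIV. a $ k * b $ l * (gauss 1 x * (x $ k * x $ l)))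
      (\<Sum>k\<in>UNIV. \<Sum>l\<in>UNIV. a $ k * b $ l * (if k = l then 1 else 0))"
    by (intro has_bochner_integral_sum has_bochner_integral_mult_right has_bochner_integral_gauss_coord2)
  moreover have "(\<Sum>k\<in>UNIV. \<Sum>l\<in>UNIV. a $ k * b $ l * (if k = l then 1 else 0)) = a \<bullet> b"
    by (simp add: inner_vec_def if_distrib[of "\<lambda>z. _ * z"] cong: if_cong)
  moreover have "(\<lambda>x::real^'n. \<Sum>k\<in>UNIV. \<Sum>l\<in>UNIV. a $ k * b $ l * (gauss 1 x * (x $ k * x $ l)))
      = (\<lambda>x. gauss 1 x * ((a \<bullet> x) * (b \<bullet> x)))"
    unfolding inner_vec_def sum_product by (simp add: fun_eq_iff sum_distrib_left mult_ac)
  ultimately show ?thesis by simp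
qed

lemma integrable_gauss_quadratic:
  "integrable lborel (\<lambda>x::real^'n::finite. gauss 1 x * (1 + norm x)\<^sup>2)"
proof (rule Bochner_Integration.integrable_bound)
  have "integrable lborel (\<lambda>x::real^'n. \<Sum>k\<in>UNIV. gauss 1 x * (x $ k * x $ k))"
    by (intro Bochner_Integration.integrable_sum has_bochner_integral_gauss_coord2[THEN integrable.intros])
  moreover have "(\<lambda>x::real^'n. \<Sum>k\<in>UNIV. gauss 1 x * (x $ k * x $ k)) = (\<lambda>x. gauss 1 x * (x \<bullet> x))"
    by (simp add: fun_eq_iff inner_vec_def sum_distrib_left)
  moreover have "integrable lborel (gauss 1 :: real^'n \<Rightarrow> real)"
    using has_bochner_integral_gauss[of 1] by (auto simp: has_bochner_integral_iff)
  ultimately show "integrable lborel (\<lambda>x::real^'n. 2 * gauss 1 x + 2 * (gauss 1 x * (x \<bullet> x)))"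
    by auto
  show "AE x::real^'n in lborel. norm (gauss 1 x * (1 + norm x)\<^sup>2) \<le> norm (2 * gauss 1 x + 2 * (gauss 1 x * (x \<bullet> x)))"
  proof (intro AE_I2)
    fix x :: "real^'n"
    have "(1 + norm x)\<^sup>2 \<le> 2 + 2 * (x \<bullet> x)"
      using sum_squares_bound[of 1 "norm x"] by (simp add: power2_sum dot_square_norm)
    then have "gauss 1 x * (1 + norm x)\<^sup>2 \<le> gauss 1 x * (2 + 2 * (x \<bullet> x))"
      by (intro mult_left_mono) auto
    then show "norm (gauss 1 x * (1 + norm x)\<^sup>2) \<le> norm (2 * gauss 1 x + 2 * (gauss 1 x * (x \<bullet> x)))"
      by (simp add: algebra_simps)
  qed
qed measurable

text \<open>Brownian scaling: the law of \<open>W\<close> at time \<open>s\<^sup>2\<close> is that of \<open>s\<close> times a standard Gaussian vector.\<close>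

lemma gauss_scale:
  fixes h :: "real ^ 'n::finite \<Rightarrow> real"
  assumes s: "0 < s" and [measurable]: "h \<in> borel_measurable borel"
  shows "(\<integral>x. gauss (s\<^sup>2) x * h x \<partial>lborel) = (\<integral>g. gauss 1 g * h (s *\<^sub>R g) \<partial>lborel)"
proof -
  have nd: "s * normal_density 0 s (s * x) = std_normal_density x" for x
    using s by (simp add: normal_density_def power_mult_distrib real_sqrt_mult)
  have [simp]: "(\<Prod>i\<in>(UNIV::'n set). s) * gauss (s\<^sup>2) (\<chi> i. s * x $ i) = gauss 1 x" for x :: "real^'n"
    unfolding gauss_def prod.distrib[symmetric] using s by (simp add: nd)
  have "(\<integral>x. gauss (s\<^sup>2) x * h x \<partial>lborel)
      = (\<integral>x. (\<Prod>i\<in>(UNIV::'n set). s) * (gauss (s\<^sup>2) (\<chi> i. s * x $ i) * h (\<chi> i. s * x $ i)) \<partial>lborel)"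
    by (subst lborel_integral_diagonal[where \<kappa>="\<chi> i. s" and c=0]) (use s in auto)
  also have "\<dots> = (\<integral>g. gauss 1 g * h (s *\<^sub>R g) \<partial>lborel)"
    by (subst mult.assoc[symmetric]) (simp add: scaleR_vec_def del: prod_constant)
  finally show ?thesis .
qed

section \<open>Second-order expansion of the transported density\<close>

lemma partial_eq_derivative:
  assumes "(f has_derivative D) (at y)"
  shows "partial i f y = D (axis i 1)"
proof -
  have lin: "((\<lambda>h. y + h *\<^sub>R axis i 1) has_derivative (\<lambda>h. h *\<^sub>R axis i 1)) (at 0)"
    by (auto intro!: derivative_eq_intros)
  have "((\<lambda>h. f (y + h *\<^sub>R axis i 1)) has_derivative (\<lambda>h. D (h *\<^sub>R axis i 1))) (at 0)"
    using diff_chain_at[OF lin, of f D] assms by (simp add: o_def)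
  then have "((\<lambda>h. f (y + h *\<^sub>R axis i 1)) has_real_derivative D (axis i 1)) (at 0)"
    unfolding has_field_derivative_def
    by (simp add: linear_scale[OF has_derivative_linear[OF assms]] mult_commute_abs)
  then show ?thesis unfolding partial_def by (rule DERIV_imp_deriv)
qed

lemma has_real_derivative_along_path:
  fixes f :: "real ^ 'd::finite \<Rightarrow> real"
  assumes f: "f differentiable (at (\<chi> i. u i s))"
    and u: "\<And>i. (u i has_real_derivative u' i) (at s)"
  shows "((\<lambda>s. f (\<chi> i. u i s)) has_real_derivative (\<Sum>i\<in>UNIV. partial i f (\<chi> i. u i s) * u' i)) (at s)"
proof -
  obtain D where D: "(f has_derivative D) (at (\<chi> i. u i s))"
    using f by (auto simp: differentiable_def)
  have rep: "(\<chi> i. v i) = (\<Sum>i\<in>UNIV. v i *\<^sub>R axis i (1::real))" for v :: "'d \<Rightarrow> real"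
    by (simp add: vec_eq_iff sum_axis_nth)
  have "((\<lambda>s. \<Sum>i\<in>UNIV. u i s *\<^sub>R axis i (1::real)) has_derivative (\<lambda>h. \<Sum>i\<in>UNIV. (u' i * h) *\<^sub>R axis i 1)) (at s)"
    using u unfolding has_field_derivative_def by (intro has_derivative_sum has_derivative_scaleR_left)
  then have "((\<lambda>s. \<chi> i. u i s) has_derivative (\<lambda>h. \<Sum>i\<in>UNIV. (u' i * h) *\<^sub>R axis i 1)) (at s)"
    by (simp only: rep)
  from diff_chain_at[OF this D]
  have "((\<lambda>s. f (\<chi> i. u i s)) has_derivative (\<lambda>h. D (\<Sum>i\<in>UNIV. (u' i * h) *\<^sub>R axis i 1))) (at s)"
    by (simp add: o_def)
  moreover have "(\<lambda>h. D (\<Sum>i\<in>UNIV. (u' i * h) *\<^sub>R axis i 1)) = (*) (\<Sum>i\<in>UNIV. partial i f (\<chi> i. u i s) * u' i)"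
    using has_derivative_linear[OF D]
    by (simp add: fun_eq_iff partial_eq_derivative[OF D] linear_sum linear_scale sum_distrib_right sum_distrib_left mult_ac)
  ultimately show ?thesis
    unfolding has_field_derivative_def by simp
qed

lemma integrable_mult_compact_support:
  fixes f h :: "'a::euclidean_space \<Rightarrow> real"
  assumes "compact K" "continuous_on UNIV f" "\<And>z. z \<notin> K \<Longrightarrow> f z = 0" "continuous_on UNIV h"
  shows "integrable lborel (\<lambda>z. f z * h z)"
proof -
  have "integrable lborel (\<lambda>z. indicator K z *\<^sub>R (f z * h z))"
    using assms by (intro borel_integrable_compact continuous_intros)
      (auto intro: continuous_on_subset)
  moreover have "(\<lambda>z. indicator K z *\<^sub>R (f z * h z)) = (\<lambda>z. f z * h z)"
    using assms(3) by (auto simp: fun_eq_iff indicator_def)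
  ultimately show ?thesis by simp
qed

text \<open>Both the limit and the uniform bound of the Taylor remainder below are read off from the
  intermediate point.\<close>

lemma second_order_remainder:
  fixes \<phi> \<phi>1 \<phi>2 :: "real \<Rightarrow> real"
  assumes "0 < s" "\<And>t. (\<phi> has_real_derivative \<phi>1 t) (at t)" "\<And>t. (\<phi>1 has_real_derivative \<phi>2 t) (at t)"
  shows "\<exists>t. 0 < t \<and> t < s \<and> \<phi> s - \<phi> 0 - s * \<phi>1 0 = s\<^sup>2 * \<phi>2 t / 2"
proof -
  define d where "d n = (if n = 0 then \<phi> else if n = 1 then \<phi>1 else \<phi>2)" for n :: nat
  have "\<forall>k t. k < 2 \<and> 0 \<le> t \<and> t \<le> s \<longrightarrow> (d k has_real_derivative d (Suc k) t) (at t)"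
    using assms by (auto simp: d_def less_2_cases_iff)
  from Maclaurin[OF \<open>0 < s\<close> _ _ this, of \<phi>] show ?thesis
    by (auto simp: d_def numeral_2_eq_2)
qed

locale twice_differentiable =
  fixes p :: "real ^ 'd::finite \<Rightarrow> real"
  assumes p_diff: "p differentiable (at y)"
    and dp_diff: "partial i p differentiable (at y)"
    and ddp_cont: "continuous_on UNIV (partial i (partial j p))"
begin

lemma p_cont: "continuous_on UNIV p"
  using p_diff by (simp add: continuous_at_imp_continuous_on differentiable_imp_continuous_within)

lemma dp_cont: "continuous_on UNIV (partial i p)"
  using dp_diff by (simp add: continuous_at_imp_continuous_on differentiable_imp_continuous_within)

end

locale transported_density = twice_differentiable p
  for p :: "real ^ 'd::finite \<Rightarrow> real" +
  fixes m :: "real ^ 'd"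
begin

text \<open>The function \<open>q a c z\<close> below is the path \<open>s \<mapsto> q a c z s\<close> of values at \<open>z\<close> of the density of the vector
  with components \<open>c\<^sup>2 s\<^sup>2 + exp (- 2 (s a\<^sub>i + c\<^sup>2 s\<^sup>2 m\<^sub>i)) Y\<^sub>i\<close>, where \<open>Y\<close> has density \<open>p\<close>: the point
  \<open>u\<close> is the preimage of \<open>z\<close> and \<open>J\<close> the Jacobian factor. Suffixes 1 and 2 denote first and second
  derivatives in \<open>s\<close>, except that \<open>expo1\<close> and \<open>expo2\<close> differentiate the exponent of \<open>expo\<close>.
  The value of interest is \<open>c = 1\<close>, with \<open>a\<^sub>i = \<alpha>\<^sub>i \<bullet> g\<close>; the parameter \<open>c\<close> makes
  the family invariant under rescaling of \<open>s\<close>, by which unbounded \<open>g\<close> reduce to a compact set of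
  parameters.\<close>

definition expo where "expo a c i s = exp (2 * (s * a $ i + c\<^sup>2 * s\<^sup>2 * m $ i))" for a :: "real ^ 'd"
definition expo1 where "expo1 a c i s = 2 * (a $ i + 2 * c\<^sup>2 * s * m $ i)" for a :: "real ^ 'd"
definition expo2 where "expo2 c i = 4 * c\<^sup>2 * m $ i"
definition u where "u a c z i s = expo a c i s * (z $ i - c\<^sup>2 * s\<^sup>2)" for a z :: "real ^ 'd"
definition u1 where "u1 a c z i s = expo1 a c i s * u a c z i s - 2 * c\<^sup>2 * s * expo a c i s" for a z :: "real ^ 'd"
definition u2 where "u2 a c z i s = expo2 c i * u a c z i s + expo1 a c i s * u1 a c z i s
   - 2 * c\<^sup>2 * expo a c i s - 2 * c\<^sup>2 * s * (expo1 a c i s * expo a c i s)" for a z :: "real ^ 'd"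
definition J where "J a c s = (\<Prod>i\<in>UNIV. expo a c i s)" for a :: "real ^ 'd"
definition J1 where "J1 a c s = (\<Sum>i\<in>UNIV. expo1 a c i s) * J a c s" for a :: "real ^ 'd"
definition J2 where "J2 a c s = (\<Sum>i\<in>UNIV. expo2 c i) * J a c s + (\<Sum>i\<in>UNIV. expo1 a c i s) * J1 a c s" for a :: "real ^ 'd"
definition q where "q a c z s = p (\<chi> i. u a c z i s) * J a c s"
definition q1 where "q1 a c z s = (\<Sum>i\<in>UNIV. partial i p (\<chi> i. u a c z i s) * u1 a c z i s) * J a c s
   + p (\<chi> i. u a c z i s) * J1 a c s"
definition q2 where "q2 a c z s =
   (\<Sum>j\<in>UNIV. (\<Sum>i\<in>UNIV. partial i (partial j p) (\<chi> i. u a c z i s) * u1 a c z i s) * u1 a c z j s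
      + partial j p (\<chi> i. u a c z i s) * u2 a c z j s) * J a c s
   + 2 * ((\<Sum>i\<in>UNIV. partial i p (\<chi> i. u a c z i s) * u1 a c z i s) * J1 a c s)
   + p (\<chi> i. u a c z i s) * J2 a c s"

lemma D_expo: "(expo a c i has_real_derivative expo1 a c i s * expo a c i s) (at s)"
  unfolding expo_def[abs_def] expo1_def by (auto intro!: derivative_eq_intros simp: algebra_simps)

lemma D_expo1: "(expo1 a c i has_real_derivative expo2 c i) (at s)"
  unfolding expo1_def[abs_def] expo2_def by (auto intro!: derivative_eq_intros simp: algebra_simps)

lemma D_u: "(u a c z i has_real_derivative u1 a c z i s) (at s)"
  unfolding u_def[abs_def] u1_def
  by (auto intro!: derivative_eq_intros D_expo simp: algebra_simps)

lemma D_u1: "(u1 a c z i has_real_derivative u2 a c z i s) (at s)"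
  unfolding u1_def[abs_def] u2_def
  by (auto intro!: derivative_eq_intros D_expo D_expo1 D_u simp: algebra_simps u1_def)

lemma J_eq_exp: "J a c s = exp (\<Sum>i\<in>UNIV. 2 * (s * a $ i + c\<^sup>2 * s\<^sup>2 * m $ i))"
  by (simp add: J_def expo_def exp_sum)

lemma D_J: "(J a c has_real_derivative J1 a c s) (at s)"
  unfolding J_eq_exp[abs_def] J1_def expo1_def
  by (auto intro!: derivative_eq_intros simp: J_eq_exp algebra_simps intro!: sum.cong)

lemma D_J1: "(J1 a c has_real_derivative J2 a c s) (at s)"
  unfolding J1_def[abs_def] J2_def
  by (auto intro!: derivative_eq_intros D_J D_expo1 simp: algebra_simps J1_def)

lemma D_q: "(q a c z has_real_derivative q1 a c z s) (at s)"
  unfolding q_def[abs_def] q1_def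
  by (auto intro!: derivative_eq_intros D_J has_real_derivative_along_path p_diff D_u simp: algebra_simps)

lemma D_q1: "(q1 a c z has_real_derivative q2 a c z s) (at s)"
  unfolding q1_def[abs_def] q2_def
  apply (rule derivative_eq_intros D_J D_J1 has_real_derivative_along_path p_diff dp_diff D_u D_u1 refl)+
  by (simp add: algebra_simps sum.distrib sum_distrib_left)

lemma
  shows continuous_on_q: "continuous_on UNIV (\<lambda>(s, a, c, z). q a c z s)"
    and continuous_on_q2: "continuous_on UNIV (\<lambda>(s, a, c, z). q2 a c z s)"
proof -
  have expo: "continuous_on UNIV (\<lambda>(s, a, c, z::real^'d). expo a c i s)" for i
    unfolding expo_def split_def by (intro continuous_intros)
  have expo1: "continuous_on UNIV (\<lambda>(s, a, c, z::real^'d). expo1 a c i s)" for i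
    unfolding expo1_def split_def by (intro continuous_intros)
  have expo2: "continuous_on UNIV (\<lambda>(s::real, a::real^'d, c, z::real^'d). expo2 c i)" for i
    unfolding expo2_def split_def by (intro continuous_intros)
  note 1 = expo[unfolded split_def] expo1[unfolded split_def] expo2[unfolded split_def]
  have u: "continuous_on UNIV (\<lambda>(s, a, c, z). u a c z i s)" for i
    unfolding u_def split_def by (intro continuous_intros 1)
  note 2 = 1 u[unfolded split_def]
  have u1: "continuous_on UNIV (\<lambda>(s, a, c, z). u1 a c z i s)" for i
    unfolding u1_def split_def by (intro continuous_intros 2)
  note 3 = 2 u1[unfolded split_def]
  have u2: "continuous_on UNIV (\<lambda>(s, a, c, z). u2 a c z i s)" for i
    unfolding u2_def split_def by (intro continuous_intros 3)
  have J: "continuous_on UNIV (\<lambda>(s, a, c, z::real^'d). J a c s)"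
    unfolding J_def split_def by (intro continuous_intros 3)
  note 4 = 3 u2[unfolded split_def] J[unfolded split_def]
  have J1: "continuous_on UNIV (\<lambda>(s, a, c, z::real^'d). J1 a c s)"
    unfolding J1_def split_def by (intro continuous_intros 4)
  note 5 = 4 J1[unfolded split_def]
  have J2: "continuous_on UNIV (\<lambda>(s, a, c, z::real^'d). J2 a c s)"
    unfolding J2_def split_def by (intro continuous_intros 5)
  note 6 = 5 J2[unfolded split_def]
  have comp: "continuous_on UNIV (\<lambda>(s, a, c, z). f (\<chi> i. u a c z i s))"
    if "continuous_on UNIV f" for f :: "real^'d \<Rightarrow> real"
    unfolding split_def
    by (rule continuous_on_compose2[OF that]) (auto intro!: continuous_on_vec_lambda 6)
  note 7 = 6 comp[OF p_cont, unfolded split_def] comp[OF dp_cont, unfolded split_def]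
     comp[OF ddp_cont, unfolded split_def]
  show "continuous_on UNIV (\<lambda>(s, a, c, z). q a c z s)"
    unfolding q_def split_def by (intro continuous_intros 7)
  show "continuous_on UNIV (\<lambda>(s, a, c, z). q2 a c z s)"
    unfolding q2_def split_def by (intro continuous_intros 7)
qed

lemma q_at_0: "q a c z 0 = p z"
  by (simp add: q_def u_def J_def expo_def)

lemma q1_at_0: "q1 a c z 0 = (\<Sum>i\<in>UNIV. a $ i * (2 * (partial i p z * z $ i + p z)))"
  by (simp add: q1_def u_def u1_def J_def J1_def expo_def expo1_def sum_distrib_left sum.distrib algebra_simps)

text \<open>For \<open>c = 1\<close> the second derivative of \<open>q\<close> at 0 is a quadratic polynomial in \<open>a\<close> without linear part; these are
  the coefficient of \<open>a\<^sub>i a\<^sub>j\<close> and the constant term. Replacing \<open>a\<^sub>i a\<^sub>j\<close> by \<open>\<alpha>\<^sub>i \<bullet> \<alpha>\<^sub>j\<close> gives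
  four times the differential equation of the theorem with all terms on one side.\<close>

definition quad_coeff where "quad_coeff z i j = 4 * (partial i (partial j p) z * z $ i * z $ j
    + (if i = j then partial j p z * z $ j else 0) + 2 * partial j p z * z $ j + p z)"

definition const_coeff where "const_coeff z = (\<Sum>i\<in>UNIV. partial i p z * (4 * m $ i * z $ i - 2)) + 4 * p z * (\<Sum>i\<in>UNIV. m $ i)"

lemma q2_at_0:
  "q2 a 1 z 0 = (\<Sum>j\<in>UNIV. \<Sum>i\<in>UNIV. a $ i * a $ j * quad_coeff z i j) + const_coeff z"
proof -
  have 1: "(\<Sum>j\<in>UNIV. \<Sum>i\<in>UNIV. a $ i * a $ j * quad_coeff z i j) =
     (\<Sum>j\<in>UNIV. (\<Sum>i\<in>UNIV. partial i (partial j p) z * (2 * a $ i * z $ i)) * (2 * a $ j * z $ j))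
     + (\<Sum>j\<in>UNIV. 4 * (a $ j)\<^sup>2 * partial j p z * z $ j)
     + 2 * ((\<Sum>j\<in>UNIV. partial j p z * (2 * a $ j * z $ j)) * (\<Sum>i\<in>UNIV. 2 * a $ i))
     + p z * (\<Sum>i\<in>UNIV. 2 * a $ i) * (\<Sum>i\<in>UNIV. 2 * a $ i)"
  proof -
    have A: "a $ i * a $ j * quad_coeff z i j = partial i (partial j p) z * (2 * a $ i * z $ i) * (2 * a $ j * z $ j)
       + (if i = j then 4 * (a $ j)\<^sup>2 * partial j p z * z $ j else 0)
       + 2 * (partial j p z * (2 * a $ j * z $ j) * (2 * a $ i))
       + p z * (2 * a $ j) * (2 * a $ i)" for i j
      by (simp add: quad_coeff_def power2_eq_square algebra_simps)
    show ?thesis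
      unfolding A sum.distrib sum_product sum_distrib_right sum_distrib_left
      apply simp
      apply (rule arg_cong2[where f="(+)"]; rule sum.swap)
      done
  qed
  show ?thesis unfolding 1
    apply (simp add: q2_def u_def u1_def u2_def J_def J1_def J2_def expo_def expo1_def expo2_def const_coeff_def
      sum_distrib_left sum_distrib_right sum.distrib sum_subtractf algebra_simps power2_eq_square)
    done
qed

lemma remainder_pointwise:
  assumes s: "\<And>n. 0 < s n" and lim: "s \<longlonglongrightarrow> 0"
  shows "(\<lambda>n. (q a c z (s n) - p z - s n * q1 a c z 0) / (s n)\<^sup>2) \<longlonglongrightarrow> q2 a c z 0 / 2"
proof -
  have "\<exists>t. 0 < t \<and> t < s n \<and> q a c z (s n) - q a c z 0 - s n * q1 a c z 0 = (s n)\<^sup>2 * q2 a c z t / 2" for n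
    by (rule second_order_remainder[OF s D_q D_q1])
  then obtain t where t: "\<And>n. 0 < t n" "\<And>n. t n < s n"
    and eq: "\<And>n. q a c z (s n) - p z - s n * q1 a c z 0 = (s n)\<^sup>2 * q2 a c z (t n) / 2"
    unfolding q_at_0 by metis
  have "t \<longlonglongrightarrow> 0"
    using t by (intro tendsto_sandwich[OF _ _ tendsto_const lim]) (auto simp: less_imp_le)
  moreover have "continuous_on UNIV (q2 a c z)"
    using continuous_on_compose2[OF continuous_on_q2, of UNIV "\<lambda>t. (t, a, c, z)"]
    by (simp add: continuous_on_Pair continuous_on_const continuous_on_id)
  ultimately have "(\<lambda>n. q2 a c z (t n)) \<longlonglongrightarrow> q2 a c z 0"
    by (intro continuous_on_tendsto_compose[of UNIV "q2 a c z" t]) auto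
  then have "(\<lambda>n. q2 a c z (t n) / 2) \<longlonglongrightarrow> q2 a c z 0 / 2"
    by (intro tendsto_intros) auto
  moreover have "(q a c z (s n) - p z - s n * q1 a c z 0) / (s n)\<^sup>2 = q2 a c z (t n) / 2" for n
    unfolding eq using s[of n] by simp
  ultimately show ?thesis by presburger
qed

lemma remainder_bound:
  assumes K: "compact K"
  shows "\<exists>C\<ge>0. \<forall>s a c z. 0 < s \<longrightarrow> s \<le> 1 \<longrightarrow> norm a \<le> R \<longrightarrow> 0 \<le> c \<longrightarrow> c \<le> 1 \<longrightarrow> z \<in> K \<longrightarrow>
     \<bar>q a c z s - p z - s * q1 a c z 0\<bar> \<le> C * s\<^sup>2"
proof -
  let ?S = "{0..1} \<times> cball (0::real^'d) R \<times> {0..1} \<times> K"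
  have "compact ((\<lambda>(s, a, c, z). q2 a c z s) ` ?S)"
    by (intro compact_continuous_image continuous_on_subset[OF continuous_on_q2 subset_UNIV]
        compact_Times compact_Icc compact_cball K)
  then have "bounded ((\<lambda>(s, a, c, z). q2 a c z s) ` ?S)"
    by (rule compact_imp_bounded)
  then obtain C where C: "0 < C" "\<And>v. v \<in> (\<lambda>(s, a, c, z). q2 a c z s) ` ?S \<Longrightarrow> norm v \<le> C"
    unfolding bounded_pos by metis
  have "\<bar>q a c z s - p z - s * q1 a c z 0\<bar> \<le> C * s\<^sup>2"
    if "0 < s" "s \<le> 1" "norm a \<le> R" "0 \<le> c" "c \<le> 1" "z \<in> K" for s a c z
  proof -
    obtain t where t: "0 < t" "t < s" "q a c z s - q a c z 0 - s * q1 a c z 0 = s\<^sup>2 * q2 a c z t / 2"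
      using second_order_remainder[OF \<open>0 < s\<close> D_q D_q1] by blast
    have "norm (q2 a c z t) \<le> C"
      using that t by (intro C(2) image_eqI[of _ _ "(t, a, c, z)"]) auto
    then have "s\<^sup>2 * \<bar>q2 a c z t\<bar> \<le> s\<^sup>2 * C" by (intro mult_left_mono) auto
    moreover have "\<bar>q a c z s - p z - s * q1 a c z 0\<bar> = s\<^sup>2 * \<bar>q2 a c z t\<bar> / 2"
      unfolding t(3)[unfolded q_at_0] by (simp add: abs_mult)
    moreover have "0 \<le> s\<^sup>2 * \<bar>q2 a c z t\<bar>" by simp
    ultimately show ?thesis unfolding mult.commute[of C] by linarith
  qed
  then show ?thesis using C(1) by (intro exI[of _ C]) auto
qed

text \<open>Only \<open>s a\<close> and \<open>c\<^sup>2 s\<^sup>2\<close> enter the definition of \<open>q\<close>.\<close>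

lemma q_rescale:
  assumes "r \<noteq> 0"
  shows "q (a /\<^sub>R r) (1 / r) z (s * r) = q a 1 z s"
    and "s * r * q1 (a /\<^sub>R r) (1 / r) z 0 = s * q1 a 1 z 0"
proof -
  have 1: "(1 / r)\<^sup>2 * (s * r)\<^sup>2 = s\<^sup>2" using assms by (simp add: power2_eq_square field_simps)
  have 2: "s * r * ((a /\<^sub>R r) $ i) = s * a $ i" for i using assms by simp
  have "expo (a /\<^sub>R r) (1 / r) i (s * r) = expo a 1 i s" for i
    unfolding expo_def 1 2 by simp
  then have "u (a /\<^sub>R r) (1 / r) z i (s * r) = u a 1 z i s" "J (a /\<^sub>R r) (1 / r) (s * r) = J a 1 s" for i
    unfolding u_def J_def 1 by simp_all
  then show "q (a /\<^sub>R r) (1 / r) z (s * r) = q a 1 z s"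
    unfolding q_def by simp
  show "s * r * q1 (a /\<^sub>R r) (1 / r) z 0 = s * q1 a 1 z 0"
    unfolding q1_at_0 sum_distrib_left using assms by (intro sum.cong) (simp_all add: field_simps)
qed

text \<open>For a bound that grows only quadratically in \<open>g\<close>, rescale by \<open>r = 1 + norm g\<close>: the direction
  divided by \<open>r\<close> and the parameter \<open>1 / r\<close> stay in a compact set, and the time becomes \<open>s r \<le> 1\<close>.
  Quadratic growth is integrable against the Gaussian density.\<close>

lemma remainder_bound_gaussian:
  fixes \<alpha> :: "'d \<Rightarrow> real ^ 'n::finite"
  assumes K: "compact K"
  shows "\<exists>C\<ge>0. \<forall>s g z. 0 < s \<longrightarrow> s * (1 + norm g) \<le> 1 \<longrightarrow> z \<in> K \<longrightarrow>
     \<bar>q (\<chi> i. \<alpha> i \<bullet> g) 1 z s - p z - s * q1 (\<chi> i. \<alpha> i \<bullet> g) 1 z 0\<bar> \<le> C * (s * (1 + norm g))\<^sup>2"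
proof -
  define R where "R = (\<Sum>i\<in>UNIV. norm (\<alpha> i))"
  obtain C where C: "C \<ge> 0" and B: "\<And>s a c z. 0 < s \<Longrightarrow> s \<le> 1 \<Longrightarrow> norm a \<le> R \<Longrightarrow> 0 \<le> c \<Longrightarrow> c \<le> 1 \<Longrightarrow> z \<in> K \<Longrightarrow>
     \<bar>q a c z s - p z - s * q1 a c z 0\<bar> \<le> C * s\<^sup>2"
    using remainder_bound[OF K, of R] by blast
  show ?thesis
  proof (intro exI[of _ C] conjI allI impI C)
    fix s :: real and g :: "real^'n" and z
    assume s: "0 < s" and s1: "s * (1 + norm g) \<le> 1" and z: "z \<in> K"
    define r where "r = 1 + norm g"
    have r: "1 \<le> r" by (simp add: r_def)
    let ?a = "\<chi> i. \<alpha> i \<bullet> g"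
    have "norm ?a \<le> (\<Sum>i\<in>UNIV. \<bar>?a $ i\<bar>)" by (rule norm_le_l1_cart)
    also have "\<dots> \<le> (\<Sum>i\<in>UNIV. norm (\<alpha> i) * norm g)"
      by (intro sum_mono) (simp add: Cauchy_Schwarz_ineq2)
    also have "\<dots> \<le> R * r"
      unfolding R_def sum_distrib_right[symmetric] by (intro mult_left_mono) (auto simp: r_def sum_nonneg)
    finally have "norm (?a /\<^sub>R r) \<le> R" using r by (simp add: field_simps)
    then have "\<bar>q (?a /\<^sub>R r) (1 / r) z (s * r) - p z - s * r * q1 (?a /\<^sub>R r) (1 / r) z 0\<bar> \<le> C * (s * r)\<^sup>2"
      using s s1 z r by (intro B) (simp_all add: r_def[symmetric])
    moreover have rn: "r \<noteq> 0" using r by simp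
    ultimately show "\<bar>q ?a 1 z s - p z - s * q1 ?a 1 z 0\<bar> \<le> C * (s * (1 + norm g))\<^sup>2"
      unfolding q_rescale[OF rn] by (simp add: r_def)
  qed
qed

text \<open>Dominated convergence twice, first in \<open>z\<close> on the support of \<open>f\<close> and then in \<open>g\<close>. The bound \<open>bd\<close> is
  needed because \<open>p\<close> may grow at infinity, so that for large \<open>g\<close> the Taylor remainder is not
  controlled; there the trivial bound suffices, as \<open>1 / s\<^sup>2\<close> is at most \<open>(1 + norm g)\<^sup>2\<close>.\<close>

lemma gaussian_average_limit:
  fixes \<alpha> :: "'d \<Rightarrow> real ^ 'n::finite" and f :: "real ^ 'd \<Rightarrow> real"
  defines "A \<equiv> \<lambda>g. \<chi> i. \<alpha> i \<bullet> g"
  assumes K: "compact K" and f: "continuous_on UNIV f" and fK: "\<And>z. z \<notin> K \<Longrightarrow> f z = 0"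
    and s: "\<And>n. 0 < s n" "\<And>n. s n \<le> 1" and lim: "s \<longlonglongrightarrow> 0"
    and bd: "\<And>s g. 0 < s \<Longrightarrow> \<bar>\<integral>z. f z * q (A g) 1 z s \<partial>lborel\<bar> \<le> B"
  shows "(\<lambda>n. ((\<integral>g. gauss 1 g * (\<integral>z. f z * q (A g) 1 z (s n) \<partial>lborel) \<partial>lborel) - (\<integral>z. f z * p z \<partial>lborel)) / (s n)\<^sup>2)
    \<longlonglongrightarrow> (\<integral>z. f z * ((\<Sum>j\<in>UNIV. \<Sum>i\<in>UNIV. (\<alpha> i \<bullet> \<alpha> j) * quad_coeff z i j) + const_coeff z) \<partial>lborel) / 2"
proof -
  note int = integrable_mult_compact_support[OF K f fK]
  have q_cont: "continuous_on UNIV (\<lambda>z. q a c z s)" for a c s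
    using continuous_on_compose2[OF continuous_on_q, of UNIV "\<lambda>z. (s, a, c, z)"]
    by (simp add: continuous_on_Pair continuous_on_const continuous_on_id)
  have quad_coeff_cont: "continuous_on UNIV (\<lambda>z. quad_coeff z i j)" for i j
    unfolding quad_coeff_def by (cases "i = j") (auto intro!: continuous_intros p_cont dp_cont ddp_cont)
  have const_coeff_cont: "continuous_on UNIV (\<lambda>z. const_coeff z)"
    unfolding const_coeff_def by (auto intro!: continuous_intros p_cont dp_cont ddp_cont)
  have q1_cont: "continuous_on UNIV (\<lambda>z. q1 a c z 0)" for a c
    unfolding q1_at_0 by (auto intro!: continuous_intros p_cont dp_cont ddp_cont)
  have fm[measurable]: "f \<in> borel_measurable borel" using f by (rule borel_measurable_continuous_onI)
  note [measurable] = q_cont[THEN borel_measurable_continuous_onI] p_cont[THEN borel_measurable_continuous_onI]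
    q1_cont[THEN borel_measurable_continuous_onI] quad_coeff_cont[THEN borel_measurable_continuous_onI]
    const_coeff_cont[THEN borel_measurable_continuous_onI]
  have [simp]: "integrable lborel (\<lambda>z. \<bar>f z\<bar>)"
    using int[of "\<lambda>_. 1"] by (intro integrable_abs) auto
  define F where "F g s = (\<integral>z. f z * q (A g) 1 z s \<partial>lborel)" for g s
  define F0 where "F0 = (\<integral>z. f z * p z \<partial>lborel)"
  define b where "b i = (\<integral>z. f z * (2 * (partial i p z * z $ i + p z)) \<partial>lborel)" for i
  define F1 where "F1 g = (\<Sum>i\<in>UNIV. (\<alpha> i \<bullet> g) * b i)" for g
  have F1: "(\<integral>z. f z * q1 (A g) 1 z 0 \<partial>lborel) = F1 g" for g
  proof -
    have "(\<integral>z. f z * q1 (A g) 1 z 0 \<partial>lborel) =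
      (\<integral>z. (\<Sum>i\<in>UNIV. (\<alpha> i \<bullet> g) * (f z * (2 * (partial i p z * z $ i + p z)))) \<partial>lborel)"
      by (simp add: q1_at_0 A_def sum_distrib_left mult_ac)
    also have "\<dots> = F1 g"
      unfolding F1_def b_def
      by (subst Bochner_Integration.integral_sum)
        (auto intro!: integrable_mult_right int continuous_intros p_cont dp_cont)
    finally show ?thesis .
  qed
  define H where "H n g = (F g (s n) - F0 - s n * F1 g) / (s n)\<^sup>2" for n g
  \<comment> \<open>\<open>H n\<close> is the Taylor remainder tested against \<open>f\<close>, and \<open>L / 2\<close> its limit.\<close>
  define L where "L g = (\<Sum>j\<in>UNIV. \<Sum>i\<in>UNIV. ((\<alpha> i \<bullet> g) * (\<alpha> j \<bullet> g)) * (\<integral>z. f z * quad_coeff z i j \<partial>lborel)) + (\<integral>z. f z * const_coeff z \<partial>lborel)" for g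
  have H_eq: "H n g = (\<integral>z. f z * ((q (A g) 1 z (s n) - p z - s n * q1 (A g) 1 z 0) / (s n)\<^sup>2) \<partial>lborel)" for n g
  proof -
    have "(\<integral>z. f z * ((q (A g) 1 z (s n) - p z - s n * q1 (A g) 1 z 0) / (s n)\<^sup>2) \<partial>lborel)
      = (\<integral>z. (f z * q (A g) 1 z (s n) - f z * p z - s n * (f z * q1 (A g) 1 z 0)) / (s n)\<^sup>2 \<partial>lborel)"
      by (intro Bochner_Integration.integral_cong) (auto simp: algebra_simps diff_divide_distrib)
    also have "\<dots> = H n g"
      unfolding H_def F_def F0_def F1[symmetric]
      by (simp add: int q_cont p_cont q1_cont)
    finally show ?thesis by simp
  qed
  have L_eq: "L g = (\<integral>z. f z * q2 (A g) 1 z 0 \<partial>lborel)" for g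
  proof -
    have "(\<integral>z. f z * q2 (A g) 1 z 0 \<partial>lborel) =
      (\<integral>z. (\<Sum>j\<in>UNIV. \<Sum>i\<in>UNIV. ((\<alpha> i \<bullet> g) * (\<alpha> j \<bullet> g)) * (f z * quad_coeff z i j)) + f z * const_coeff z \<partial>lborel)"
      by (simp add: q2_at_0 A_def sum_distrib_left mult_ac distrib_left)
    also have "\<dots> = L g"
      unfolding L_def
      by (simp add: int quad_coeff_cont const_coeff_cont Bochner_Integration.integral_sum)
    finally show ?thesis by simp
  qed
  have H_lim: "(\<lambda>n. H n g) \<longlonglongrightarrow> L g / 2" for g
  proof -
    obtain C where C: "C \<ge> 0" "\<And>s a c z. 0 < s \<Longrightarrow> s \<le> 1 \<Longrightarrow> norm a \<le> norm (A g) \<Longrightarrow> 0 \<le> c \<Longrightarrow> c \<le> 1 \<Longrightarrow> z \<in> K \<Longrightarrow>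
       \<bar>q a c z s - p z - s * q1 a c z 0\<bar> \<le> C * s\<^sup>2"
      using remainder_bound[OF K, of "norm (A g)"] by blast
    have "(\<lambda>n. \<integral>z. f z * ((q (A g) 1 z (s n) - p z - s n * q1 (A g) 1 z 0) / (s n)\<^sup>2) \<partial>lborel)
      \<longlonglongrightarrow> (\<integral>z. f z * (q2 (A g) 1 z 0 / 2) \<partial>lborel)"
    proof (rule integral_dominated_convergence[where w="\<lambda>z. \<bar>f z\<bar> * C"])
      show "AE z in lborel. (\<lambda>n. f z * ((q (A g) 1 z (s n) - p z - s n * q1 (A g) 1 z 0) / (s n)\<^sup>2))
          \<longlonglongrightarrow> f z * (q2 (A g) 1 z 0 / 2)"
        by (intro AE_I2 tendsto_mult tendsto_const remainder_pointwise s lim)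
      show "AE z in lborel. norm (f z * ((q (A g) 1 z (s n) - p z - s n * q1 (A g) 1 z 0) / (s n)\<^sup>2)) \<le> \<bar>f z\<bar> * C" for n
      proof (intro AE_I2)
        fix z
        show "norm (f z * ((q (A g) 1 z (s n) - p z - s n * q1 (A g) 1 z 0) / (s n)\<^sup>2)) \<le> \<bar>f z\<bar> * C"
        proof (cases "z \<in> K")
          case True
          have "\<bar>q (A g) 1 z (s n) - p z - s n * q1 (A g) 1 z 0\<bar> / (s n)\<^sup>2 \<le> C"
            using C(2)[of "s n" "A g" 1 z] s[of n] True by (simp add: divide_le_eq)
          from mult_left_mono[OF this, of "\<bar>f z\<bar>"] show ?thesis by (simp add: abs_mult)
        qed (simp add: fK)
      qed
      show "(\<lambda>z. f z * (q2 (A g) 1 z 0 / 2)) \<in> borel_measurable lborel"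
        unfolding q2_at_0 by measurable
      show "(\<lambda>z. f z * ((q (A g) 1 z (s n) - p z - s n * q1 (A g) 1 z 0) / (s n)\<^sup>2)) \<in> borel_measurable lborel" for n
        by measurable
    qed simp
    then show ?thesis unfolding H_eq L_eq by simp
  qed
  obtain C where C: "C \<ge> 0" "\<And>s g z. 0 < s \<Longrightarrow> s * (1 + norm g) \<le> 1 \<Longrightarrow> z \<in> K \<Longrightarrow>
     \<bar>q (A g) 1 z s - p z - s * q1 (A g) 1 z 0\<bar> \<le> C * (s * (1 + norm g))\<^sup>2"
    using remainder_bound_gaussian[OF K, of \<alpha>] unfolding A_def by blast
  define I where "I = (\<integral>z. \<bar>f z\<bar> \<partial>lborel)"
  define \<beta> where "\<beta> = (\<Sum>i\<in>UNIV. norm (\<alpha> i) * \<bar>b i\<bar>)"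
  have F1_bd: "\<bar>F1 g\<bar> \<le> \<beta> * (1 + norm g)" for g
  proof -
    have "\<bar>F1 g\<bar> \<le> (\<Sum>i\<in>UNIV. \<bar>(\<alpha> i \<bullet> g) * b i\<bar>)" unfolding F1_def by (rule sum_abs)
    also have "\<dots> \<le> (\<Sum>i\<in>UNIV. norm (\<alpha> i) * norm g * \<bar>b i\<bar>)"
      by (intro sum_mono) (simp add: abs_mult Cauchy_Schwarz_ineq2 mult_right_mono)
    also have "\<dots> = \<beta> * norm g" by (simp add: \<beta>_def sum_distrib_left mult_ac)
    also have "\<dots> \<le> \<beta> * (1 + norm g)" by (intro mult_left_mono) (auto simp: \<beta>_def intro!: sum_nonneg)
    finally show ?thesis .
  qed
  have \<beta>0: "0 \<le> \<beta>" by (auto simp: \<beta>_def intro!: sum_nonneg)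
  define D where "D = I * C + B + \<bar>F0\<bar> + \<beta>"
  have I0: "0 \<le> I" by (auto simp: I_def)
  have B0: "0 \<le> B" using bd[of 1 0] by linarith
  have H_bd: "\<bar>H n g\<bar> \<le> D * (1 + norm g)\<^sup>2" for n g
  proof (cases "s n * (1 + norm g) \<le> 1")
    case True
    have "norm (H n g) \<le> (\<integral>z. norm (f z * ((q (A g) 1 z (s n) - p z - s n * q1 (A g) 1 z 0) / (s n)\<^sup>2)) \<partial>lborel)"
      unfolding H_eq by (rule integral_norm_bound)
    also have "\<dots> \<le> (\<integral>z. \<bar>f z\<bar> * (C * (1 + norm g)\<^sup>2) \<partial>lborel)"
    proof (intro integral_mono)
      show "integrable lborel (\<lambda>z. norm (f z * ((q (A g) 1 z (s n) - p z - s n * q1 (A g) 1 z 0) / (s n)\<^sup>2)))"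
        by (intro integrable_norm int continuous_intros q_cont p_cont q1_cont) (use s[of n] in auto)
      fix z
      show "norm (f z * ((q (A g) 1 z (s n) - p z - s n * q1 (A g) 1 z 0) / (s n)\<^sup>2)) \<le> \<bar>f z\<bar> * (C * (1 + norm g)\<^sup>2)"
      proof (cases "z \<in> K")
        case z: True
        have "\<bar>q (A g) 1 z (s n) - p z - s n * q1 (A g) 1 z 0\<bar> / (s n)\<^sup>2 \<le> C * (1 + norm g)\<^sup>2"
          using C(2)[of "s n" g z] s[of n] True z by (simp add: divide_le_eq power_mult_distrib mult_ac)
        from mult_left_mono[OF this, of "\<bar>f z\<bar>"] show ?thesis by (simp add: abs_mult)
      qed (simp add: fK)
    qed simp
    also have "\<dots> = I * C * (1 + norm g)\<^sup>2" by (simp add: I_def mult_ac)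
    also have "\<dots> \<le> D * (1 + norm g)\<^sup>2"
      using \<beta>0 B0 by (intro mult_right_mono) (auto simp: D_def)
    finally show ?thesis by simp
  next
    case False
    define r where "r = 1 + norm g"
    have r: "1 < s n * r" using False by (simp add: r_def)
    have rpos: "1 \<le> r" by (simp add: r_def)
    have "\<bar>H n g\<bar> = \<bar>F g (s n) - F0 - s n * F1 g\<bar> / (s n)\<^sup>2"
      by (simp add: H_def)
    also have "\<dots> \<le> (B + \<bar>F0\<bar> + s n * (\<beta> * r)) / (s n)\<^sup>2"
    proof (intro divide_right_mono)
      have "\<bar>s n * F1 g\<bar> \<le> s n * (\<beta> * r)"
        using F1_bd[of g] s[of n] by (simp add: abs_mult r_def mult_left_mono)
      then show "\<bar>F g (s n) - F0 - s n * F1 g\<bar> \<le> B + \<bar>F0\<bar> + s n * (\<beta> * r)"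
        using bd[of "s n" g] s(1)[of n] unfolding F_def by linarith
    qed simp
    also have "\<dots> \<le> (B + \<bar>F0\<bar> + \<beta>) * r\<^sup>2"
    proof -
      \<comment> \<open>Here \<open>s n\<close> is not small compared with \<open>1 / r\<close>, so factors \<open>s n * r\<close> can be inserted.\<close>
      have sr: "1 \<le> (s n * r)\<^sup>2" using r by (simp add: one_le_power)
      have "s n * r \<le> (s n * r)\<^sup>2" using r by (intro self_le_power) auto
      from mult_left_mono[OF this \<beta>0] have "s n * (\<beta> * r) \<le> \<beta> * (s n * r)\<^sup>2"
        by (simp add: mult_ac)
      moreover have "B + \<bar>F0\<bar> \<le> (B + \<bar>F0\<bar>) * (s n * r)\<^sup>2"
        using mult_left_mono[OF sr, of "B + \<bar>F0\<bar>"] B0 by simp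
      ultimately have "B + \<bar>F0\<bar> + s n * (\<beta> * r) \<le> (B + \<bar>F0\<bar> + \<beta>) * (s n * r)\<^sup>2"
        unfolding distrib_right[of "B + \<bar>F0\<bar>"] by (rule add_mono[rotated])
      also have "\<dots> = (B + \<bar>F0\<bar> + \<beta>) * r\<^sup>2 * (s n)\<^sup>2" by (simp add: power_mult_distrib)
      finally show ?thesis using s(1)[of n] by (simp add: pos_divide_le_eq)
    qed
    also have "\<dots> \<le> D * r\<^sup>2"
      using I0 C(1) by (intro mult_right_mono) (auto simp: D_def)
    finally show ?thesis by (simp add: r_def)
  qed
  have F_meas[measurable]: "(\<lambda>g. F g t) \<in> borel_measurable borel" for t
  proof -
    have "continuous_on UNIV (\<lambda>(g, z). f z * q (A g) 1 z t)"
    proof -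
      have A: "continuous_on UNIV (\<lambda>x::(real^'n) \<times> (real^'d). A (fst x))"
        unfolding A_def by (intro continuous_on_vec_lambda continuous_intros)
      have "continuous_on UNIV (\<lambda>x::(real^'n) \<times> (real^'d). (t, A (fst x), 1::real, snd x))"
        by (intro continuous_on_Pair continuous_on_const continuous_on_snd continuous_on_id A)
      from continuous_on_compose2[OF continuous_on_q this]
      have "continuous_on UNIV (\<lambda>x::(real^'n) \<times> (real^'d). q (A (fst x)) 1 (snd x) t)"
        by simp
      moreover have "continuous_on UNIV (\<lambda>x::(real^'n) \<times> (real^'d). f (snd x))"
        by (rule continuous_on_compose2[OF f continuous_on_snd[OF continuous_on_id]]) simp
      ultimately show ?thesis unfolding split_def by (rule continuous_on_mult[rotated])
    qed
    then have "(\<lambda>(g, z). f z * q (A g) 1 z t) \<in> borel_measurable (borel \<Otimes>\<^sub>M borel)"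
      unfolding borel_prod by (rule borel_measurable_continuous_onI)
    then have [measurable]: "(\<lambda>(g, z). f z * q (A g) 1 z t) \<in> borel_measurable (borel \<Otimes>\<^sub>M lborel)"
      by (subst measurable_cong_sets[OF sets_pair_measure_cong[OF refl sets_lborel] refl])
    show ?thesis unfolding F_def by measurable
  qed
  have [measurable]: "F1 \<in> borel_measurable borel" "L \<in> borel_measurable borel"
    unfolding F1_def[abs_def] L_def[abs_def] by measurable
  have [measurable]: "H n \<in> borel_measurable borel" for n
    unfolding H_def[abs_def] by measurable
  have lim2: "(\<lambda>n. \<integral>g. gauss 1 g * H n g \<partial>lborel) \<longlonglongrightarrow> (\<integral>g. gauss 1 g * (L g / 2) \<partial>lborel)"
  proof (rule integral_dominated_convergence[where w="\<lambda>g. D * (gauss 1 g * (1 + norm g)\<^sup>2)"])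
    show "integrable lborel (\<lambda>g::real^'n. D * (gauss 1 g * (1 + norm g)\<^sup>2))"
      by (intro integrable_mult_right integrable_gauss_quadratic)
    show "AE g in lborel. (\<lambda>n. gauss 1 g * H n g) \<longlonglongrightarrow> gauss 1 g * (L g / 2)"
      by (intro AE_I2 tendsto_mult tendsto_const H_lim)
    show "AE g in lborel. norm (gauss 1 g * H n g) \<le> D * (gauss 1 g * (1 + norm g)\<^sup>2)" for n
    proof (intro AE_I2)
      fix g
      have "gauss 1 g * \<bar>H n g\<bar> \<le> gauss 1 g * (D * (1 + norm g)\<^sup>2)"
        by (rule mult_left_mono[OF H_bd gauss_nonneg])
      then show "norm (gauss 1 g * H n g) \<le> D * (gauss 1 g * (1 + norm g)\<^sup>2)"
        by (simp add: abs_mult mult.left_commute)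
    qed
    show "(\<lambda>g. gauss 1 g * (L g / 2)) \<in> borel_measurable lborel" by simp
    show "(\<lambda>g. gauss 1 g * H n g) \<in> borel_measurable lborel" for n by simp
  qed
  have g1: "has_bochner_integral lborel (gauss 1 :: real^'n \<Rightarrow> real) 1"
    by (rule has_bochner_integral_gauss) simp
  have gF: "integrable lborel (\<lambda>g. gauss 1 g * F g (s n))" for n
    by (rule Bochner_Integration.integrable_bound[of _ "\<lambda>g. gauss 1 g * B"])
      (use g1 bd[OF s(1)] in \<open>auto simp: has_bochner_integral_iff F_def[symmetric] abs_mult abs_of_nonneg[OF B0] intro!: mult_left_mono\<close>)
  have hF1: "has_bochner_integral lborel (\<lambda>g. gauss 1 g * F1 g) 0"
  proof -
    have "has_bochner_integral lborel (\<lambda>g. \<Sum>i\<in>UNIV. b i * (gauss 1 g * (\<alpha> i \<bullet> g))) (\<Sum>i\<in>UNIV. b i * 0)"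
      by (intro has_bochner_integral_sum has_bochner_integral_mult_right has_bochner_integral_gauss_inner)
    then show ?thesis by (simp add: F1_def sum_distrib_left mult_ac)
  qed
  have eqH: "(\<integral>g. gauss 1 g * H n g \<partial>lborel) = ((\<integral>g. gauss 1 g * F g (s n) \<partial>lborel) - F0) / (s n)\<^sup>2" for n
  proof -
    have "(\<integral>g. gauss 1 g * H n g \<partial>lborel) =
      (\<integral>g. (gauss 1 g * F g (s n) - gauss 1 g * F0 - s n * (gauss 1 g * F1 g)) / (s n)\<^sup>2 \<partial>lborel)"
      by (intro Bochner_Integration.integral_cong) (auto simp: H_def algebra_simps diff_divide_distrib)
    also have "\<dots> = ((\<integral>g. gauss 1 g * F g (s n) \<partial>lborel) - F0) / (s n)\<^sup>2"
      using gF[of n] g1 hF1 by (simp add: has_bochner_integral_iff)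
    finally show ?thesis .
  qed
  have "has_bochner_integral lborel (\<lambda>g. (\<Sum>j\<in>UNIV. \<Sum>i\<in>UNIV. (\<integral>z. f z * quad_coeff z i j \<partial>lborel) * (gauss 1 g * ((\<alpha> i \<bullet> g) * (\<alpha> j \<bullet> g))))
      + (\<integral>z. f z * const_coeff z \<partial>lborel) * gauss 1 g)
     ((\<Sum>j\<in>UNIV. \<Sum>i\<in>UNIV. (\<integral>z. f z * quad_coeff z i j \<partial>lborel) * (\<alpha> i \<bullet> \<alpha> j)) + (\<integral>z. f z * const_coeff z \<partial>lborel) * 1)"
    by (intro has_bochner_integral_add has_bochner_integral_sum has_bochner_integral_mult_right has_bochner_integral_gauss_inner2 g1)
  also have "(\<lambda>g. (\<Sum>j\<in>UNIV. \<Sum>i\<in>UNIV. (\<integral>z. f z * quad_coeff z i j \<partial>lborel) * (gauss 1 g * ((\<alpha> i \<bullet> g) * (\<alpha> j \<bullet> g))))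
      + (\<integral>z. f z * const_coeff z \<partial>lborel) * gauss 1 g) = (\<lambda>g. gauss 1 g * L g)"
    by (simp add: fun_eq_iff L_def distrib_left sum_distrib_left mult_ac)
  finally have "(\<integral>g. gauss 1 g * L g \<partial>lborel) =
     (\<Sum>j\<in>UNIV. \<Sum>i\<in>UNIV. (\<integral>z. f z * quad_coeff z i j \<partial>lborel) * (\<alpha> i \<bullet> \<alpha> j)) + (\<integral>z. f z * const_coeff z \<partial>lborel)"
    by (simp add: has_bochner_integral_iff)
  also have "\<dots> = (\<integral>z. (\<Sum>j\<in>UNIV. \<Sum>i\<in>UNIV. (f z * quad_coeff z i j) * (\<alpha> i \<bullet> \<alpha> j)) + f z * const_coeff z \<partial>lborel)"
    by (simp add: int quad_coeff_cont const_coeff_cont Bochner_Integration.integral_sum)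
  also have "\<dots> = (\<integral>z. f z * ((\<Sum>j\<in>UNIV. \<Sum>i\<in>UNIV. (\<alpha> i \<bullet> \<alpha> j) * quad_coeff z i j) + const_coeff z) \<partial>lborel)"
    by (simp add: distrib_left sum_distrib_left mult_ac)
  finally show ?thesis
    using lim2 unfolding eqH by (simp add: F_def F0_def)
qed

end

section \<open>Riemann sums and improper integrals\<close>

lemma left_Riemann_sum_error:
  fixes v :: "real \<Rightarrow> real"
  assumes h: "0 \<le> h" and e: "0 \<le> e" and cont: "continuous_on {0..real N * h} v"
    and osc: "\<And>x y. x \<in> {0..real N * h} \<Longrightarrow> y \<in> {0..real N * h} \<Longrightarrow> \<bar>x - y\<bar> \<le> h \<Longrightarrow> \<bar>v x - v y\<bar> \<le> e"
    and k: "k \<le> N"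
  shows "\<bar>integral {0..real k * h} v - h * (\<Sum>j<k. v (real j * h))\<bar> \<le> real k * h * e"
  using k
proof (induction k)
  case 0
  show ?case by simp
next
  case (Suc k)
  define a where "a = real k * h"
  have "real (Suc k) * h \<le> real N * h" using Suc.prems h by (intro mult_right_mono) auto
  then have a: "0 \<le> a" "a + h \<le> real N * h" using h by (auto simp: a_def algebra_simps)
  have int: "v integrable_on S" if "S = {x..y}" "0 \<le> x" "y \<le> real N * h" for S x y
    unfolding that(1) using that by (intro integrable_continuous_real continuous_on_subset[OF cont]) auto
  have "((\<lambda>s. v s - v a) has_integral (integral {a..a+h} v - h * v a)) {a..a+h}"
    using has_integral_const_real[of "v a" a "a + h"] h
    by (intro has_integral_diff integrable_integral int[OF refl]) (use a in auto)
  from has_integral_bound_real[OF e finite.emptyI this]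
  have 1: "\<bar>integral {a..a+h} v - h * v a\<bar> \<le> e * h"
    using osc a h by auto
  have 2: "integral {0..a} v + integral {a..a+h} v = integral {0..a+h} v"
    using a h by (intro Henstock_Kurzweil_Integration.integral_combine int[OF refl]) auto
  have "\<bar>integral {0..a} v - h * (\<Sum>j<k. v (real j * h))\<bar> \<le> a * e"
    using Suc.IH Suc.prems by (simp add: a_def)
  moreover have "real (Suc k) * h = a + h" by (simp add: a_def algebra_simps)
  ultimately show ?case using 1 2 by (simp add: a_def[symmetric] algebra_simps)
qed

lemma left_Riemann_sum_tendsto:
  fixes v :: "real \<Rightarrow> real"
  assumes T: "0 < T" and cont: "continuous_on {0..T} v"
  shows "(\<lambda>n. T / real (Suc n) * (\<Sum>j<Suc n. v (real j * (T / real (Suc n))))) \<longlonglongrightarrow> integral {0..T} v"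
proof (rule LIMSEQ_I)
  fix r :: real assume r: "0 < r"
  define e where "e = r / (2 * T)"
  have e: "0 < e" using r T by (simp add: e_def)
  obtain d where d: "0 < d" "\<And>x y. x \<in> {0..T} \<Longrightarrow> y \<in> {0..T} \<Longrightarrow> \<bar>x - y\<bar> < d \<Longrightarrow> \<bar>v x - v y\<bar> < e"
    using compact_uniformly_continuous[OF cont] e unfolding uniformly_continuous_on_def dist_real_def
    by (metis abs_minus_commute compact_Icc)
  have "(\<lambda>n. T / real (Suc n)) \<longlonglongrightarrow> 0"
    by (intro lim_const_over_n[THEN LIMSEQ_Suc])
  then obtain n0 where n0: "\<And>n. n \<ge> n0 \<Longrightarrow> \<bar>T / real (Suc n)\<bar> < d"
    using d(1) by (auto simp: LIMSEQ_iff)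
  show "\<exists>n0. \<forall>n\<ge>n0. norm (T / real (Suc n) * (\<Sum>j<Suc n. v (real j * (T / real (Suc n)))) - integral {0..T} v) < r"
  proof (intro exI[of _ n0] allI impI)
    fix n assume n: "n0 \<le> n"
    define h where "h = T / real (Suc n)"
    have h: "0 \<le> h" "real (Suc n) * h = T" "h < d" using T n0[OF n] by (auto simp: h_def)
    have "\<bar>integral {0..real (Suc n) * h} v - h * (\<Sum>j<Suc n. v (real j * h))\<bar> \<le> real (Suc n) * h * e"
    proof (rule left_Riemann_sum_error[where N="Suc n"])
      show "0 \<le> h" "0 \<le> e" "continuous_on {0..real (Suc n) * h} v" using h e cont by auto
      fix x y assume "x \<in> {0..real (Suc n) * h}" "y \<in> {0..real (Suc n) * h}" "\<bar>x - y\<bar> \<le> h"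
      then show "\<bar>v x - v y\<bar> \<le> e" using d(2)[of x y] h(3) unfolding h(2) by auto
    qed simp
    then have "\<bar>integral {0..T} v - h * (\<Sum>j<Suc n. v (real j * h))\<bar> \<le> T * e"
      unfolding h(2) .
    moreover have "T * e < r" using T r by (simp add: e_def)
    ultimately show "norm (T / real (Suc n) * (\<Sum>j<Suc n. v (real j * (T / real (Suc n)))) - integral {0..T} v) < r"
      unfolding h_def[symmetric] by (simp add: abs_minus_commute)
  qed
qed

text \<open>The Lebesgue integral over the half-line is the limit of integrals over bounded intervals, the
  form in which Riemann sums reach it.\<close>

lemma integral_tail_tendsto:
  fixes v :: "real \<Rightarrow> real"
  assumes cont: "continuous_on {0..} v" and int: "set_integrable lborel {0..} v" and t: "0 \<le> t"
  shows "(\<lambda>k. integral {0..real (Suc k)} (\<lambda>s. v (t + s))) \<longlonglongrightarrow> (LINT s:{0..}|lborel. v s) - integral {0..t} v"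
proof -
  have "((\<lambda>y. \<integral>x. indicator {..y} x *\<^sub>R (indicator {0..} x *\<^sub>R v x) \<partial>lborel) \<longlongrightarrow> (LINT s:{0..}|lborel. v s)) at_top"
    using tendsto_integral_at_top[of lborel "\<lambda>x. indicator {0..} x *\<^sub>R v x"] int
    by (simp add: set_integrable_def set_lebesgue_integral_def)
  moreover have "(\<integral>x. indicator {..y} x *\<^sub>R (indicator {0..} x *\<^sub>R v x) \<partial>lborel) = integral {0..y} v" for y
  proof -
    have "(\<integral>x. indicator {..y} x *\<^sub>R (indicator {0..} x *\<^sub>R v x) \<partial>lborel) = (LINT x:{0..y}|lborel. v x)"
      unfolding set_lebesgue_integral_def
      by (intro Bochner_Integration.integral_cong) (auto simp: indicator_def)
    also have "\<dots> = integral {0..y} v"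
      by (intro set_borel_integral_eq_integral set_integrable_subset[OF int]) auto
    finally show ?thesis .
  qed
  ultimately have lim: "((\<lambda>y. integral {0..y} v) \<longlongrightarrow> (LINT s:{0..}|lborel. v s)) at_top" by simp
  have "filterlim (\<lambda>k. t + real (Suc k)) at_top sequentially"
    by real_asymp
  from filterlim_compose[OF lim this]
  have "(\<lambda>k. integral {0..t + real (Suc k)} v - integral {0..t} v) \<longlonglongrightarrow> (LINT s:{0..}|lborel. v s) - integral {0..t} v"
    by (intro tendsto_diff tendsto_const)
  moreover have "integral {0..t + real (Suc k)} v - integral {0..t} v = integral {0..real (Suc k)} (\<lambda>s. v (t + s))" for k
  proof -
    have "integral {0..t} v + integral {t..t + real (Suc k)} v = integral {0..t + real (Suc k)} v"
      using t by (intro Henstock_Kurzweil_Integration.integral_combine integrable_continuous_real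
        continuous_on_subset[OF cont]) auto
    then show ?thesis
      using integral_shift_Icc_real[of 0 "real (Suc k)" v t] by (simp add: o_def add_ac)
  qed
  ultimately show ?thesis by simp
qed

section \<open>Renewal of the increments\<close>

locale drifted_bm =
  fixes M :: "'w measure" and B :: "real \<Rightarrow> 'w \<Rightarrow> real ^ 'n::finite" and \<mu> :: "real ^ 'n"
    and \<alpha> :: "'d::finite \<Rightarrow> real ^ 'n"
  assumes bm: "brownian_motion_with_drift M \<mu> B"
begin

definition W where "W t \<omega> = B t \<omega> - t *\<^sub>R \<mu>"

lemma sbm: "standard_brownian_motion M W"
  using bm by (simp add: brownian_motion_with_drift_def W_def[abs_def])

sublocale prob_space M
  using sbm by (simp add: standard_brownian_motion_def)

lemma W_measurable[measurable]: "0 \<le> t \<Longrightarrow> W t \<in> borel_measurable M"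
  using sbm by (simp add: standard_brownian_motion_def)

lemma B_start: "AE \<omega> in M. B 0 \<omega> = 0"
  using sbm by (simp add: standard_brownian_motion_def W_def)

lemma B_cont: "AE \<omega> in M. continuous_on {0..} (\<lambda>t. B t \<omega>)"
proof -
  have "AE \<omega> in M. continuous_on {0..} (\<lambda>t. W t \<omega>)"
    using sbm by (simp add: standard_brownian_motion_def)
  then show ?thesis
  proof eventually_elim
    case (elim \<omega>)
    then have "continuous_on {0..} (\<lambda>t. W t \<omega> + t *\<^sub>R \<mu>)" by (intro continuous_intros)
    then show ?case by (simp add: W_def)
  qed
qed

text \<open>Because \<open>W 0\<close> vanishes merely almost surely, the position at time \<open>t\<close> is represented below by the
  increment \<open>W t \<omega> - W 0 \<omega>\<close>.\<close>

lemma W_indep: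
  fixes t :: "nat \<Rightarrow> real"
  assumes "0 \<le> t 0" "incseq t"
  shows "indep_vars (\<lambda>_. borel) (\<lambda>j \<omega>. W (t (Suc j)) \<omega> - W (t j) \<omega>) {..<k}"
  using sbm assms unfolding standard_brownian_motion_def by blast

lemma W_increment_density:
  assumes "0 \<le> s" "s < t"
  shows "distributed M lborel (\<lambda>\<omega>. W t \<omega> - W s \<omega>) (\<lambda>x. ennreal (gauss (t - s) x))"
  using sbm assms unfolding standard_brownian_motion_def gauss_def by blast

lemma W_increment_distr:
  assumes "0 \<le> s" "s < t"
  shows "distr M borel (\<lambda>\<omega>. W t \<omega> - W s \<omega>) = density lborel (\<lambda>x. ennreal (gauss (t - s) x))"
  using distributed_distr_eq_density[OF W_increment_density[OF assms]]
  by (simp cong: distr_cong)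

lemma W_increment_integral:
  fixes h :: "real ^ 'n \<Rightarrow> real"
  assumes "0 \<le> s" "s < t" and [measurable]: "h \<in> borel_measurable borel"
  shows "expectation (\<lambda>\<omega>. h (W t \<omega> - W s \<omega>)) = (\<integral>x. gauss (t - s) x * h x \<partial>lborel)"
    and "integrable M (\<lambda>\<omega>. h (W t \<omega> - W s \<omega>)) \<longleftrightarrow> integrable lborel (\<lambda>x. gauss (t - s) x * h x)"
  using distributed_integral[OF W_increment_density[OF assms(1,2)], of h]
    distributed_integrable[OF W_increment_density[OF assms(1,2)], of h] by auto

definition incr where "incr t h j \<omega> = W (t + real (Suc j) * h) \<omega> - W (t + real j * h) \<omega>"

lemma incr_measurable[measurable]: "0 \<le> t \<Longrightarrow> 0 \<le> h \<Longrightarrow> incr t h j \<in> borel_measurable M"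
  unfolding incr_def[abs_def] by (intro borel_measurable_diff W_measurable) auto

text \<open>The right-hand side does not depend on \<open>t\<close>: this is the equality in law of the path and the
  restarted path.\<close>

lemma incr_law:
  assumes t: "0 \<le> t" and h: "0 < h" and N: "0 < N"
  shows "distr M (Pi\<^sub>M {..<N} (\<lambda>_. borel)) (\<lambda>\<omega>. \<lambda>j\<in>{..<N}. incr t h j \<omega>)
    = Pi\<^sub>M {..<N} (\<lambda>_. density lborel (\<lambda>x::real^'n. ennreal (gauss h x)))"
proof -
  have "indep_vars (\<lambda>_. borel) (incr t h) {..<N}"
    using W_indep[of "\<lambda>j. t + real j * h" N] t h
    by (simp add: incr_def[abs_def] incseq_def mult_right_mono)
  moreover have "{..<N} \<noteq> {}" using N by auto
  ultimately have "distr M (Pi\<^sub>M {..<N} (\<lambda>_. borel)) (\<lambda>\<omega>. \<lambda>j\<in>{..<N}. incr t h j \<omega>)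
      = Pi\<^sub>M {..<N} (\<lambda>j. distr M borel (incr t h j))"
    using t h by (subst (asm) indep_vars_iff_distr_eq_PiM') auto
  also have "\<dots> = Pi\<^sub>M {..<N} (\<lambda>_. density lborel (\<lambda>x::real^'n. ennreal (gauss h x)))"
  proof (intro PiM_cong refl)
    fix j
    have *: "t + real (Suc j) * h - (t + real j * h) = h" by (simp add: algebra_simps)
    show "distr M borel (incr t h j) = density lborel (\<lambda>x::real^'n. ennreal (gauss h x))"
      using W_increment_distr[of "t + real j * h" "t + real (Suc j) * h"] t h
      unfolding incr_def[abs_def] * by (simp add: mult_strict_right_mono)
  qed
  finally show ?thesis .
qed

text \<open>Independence of the past increment and the future ones, in the form of a double expectation: the
  future may be replaced by an independent copy.\<close>

lemma incr_indep:
  fixes \<psi> :: "(real ^ 'n) \<times> (nat \<Rightarrow> real ^ 'n) \<Rightarrow> real"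
  assumes t: "0 \<le> t" and h: "0 < h"
    and \<psi>[measurable]: "\<psi> \<in> borel_measurable (borel \<Otimes>\<^sub>M Pi\<^sub>M {..<N} (\<lambda>_. borel))" and bd: "\<And>x. \<bar>\<psi> x\<bar> \<le> C"
  shows "expectation (\<lambda>\<omega>. \<psi> (W t \<omega> - W 0 \<omega>, \<lambda>j\<in>{..<N}. incr t h j \<omega>))
    = expectation (\<lambda>\<omega>. expectation (\<lambda>\<omega>'. \<psi> (W t \<omega> - W 0 \<omega>, \<lambda>j\<in>{..<N}. incr t h j \<omega>')))"
proof -
  \<comment> \<open>The first increment runs over \<open>[0, t]\<close>, the later ones over the mesh after \<open>t\<close>.\<close>
  define \<tau> where "\<tau> j = (if j = 0 then 0 else t + real (j - 1) * h)" for j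
  have "incseq \<tau>" "0 \<le> \<tau> 0"
    unfolding incseq_Suc_iff using t h by (auto simp: \<tau>_def algebra_simps of_nat_diff)
  then have ind: "indep_vars (\<lambda>_. borel) (\<lambda>j \<omega>. W (\<tau> (Suc j)) \<omega> - W (\<tau> j) \<omega>) {..<Suc N}"
    by (intro W_indep)
  define X where "X \<omega> = restrict (\<lambda>j. W (\<tau> (Suc j)) \<omega> - W (\<tau> j) \<omega>) {0}" for \<omega>
  define Y where "Y \<omega> = restrict (\<lambda>j. W (\<tau> (Suc j)) \<omega> - W (\<tau> j) \<omega>) {Suc 0..<Suc N}" for \<omega>
  let ?P = "Pi\<^sub>M {0::nat} (\<lambda>_. borel :: (real^'n) measure)" and ?Q = "Pi\<^sub>M {Suc 0..<Suc N} (\<lambda>_. borel :: (real^'n) measure)"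
  have "indep_var ?P X ?Q Y"
    unfolding X_def[abs_def] Y_def[abs_def] by (rule indep_var_restrict[OF ind]) auto
  then have [measurable]: "X \<in> measurable M ?P" "Y \<in> measurable M ?Q"
    and joint: "distr M ?P X \<Otimes>\<^sub>M distr M ?Q Y = distr M (?P \<Otimes>\<^sub>M ?Q) (\<lambda>\<omega>. (X \<omega>, Y \<omega>))"
    unfolding indep_var_distribution_eq by auto
  define \<Psi> where "\<Psi> = (\<lambda>(a, b). \<psi> (a (0::nat), \<lambda>j\<in>{..<N}. b (Suc j)))"
  have [measurable]: "\<Psi> \<in> borel_measurable (?P \<Otimes>\<^sub>M ?Q)"
    unfolding \<Psi>_def by measurable
  have eq: "\<Psi> (X \<omega>, Y \<omega>') = \<psi> (W t \<omega> - W 0 \<omega>, \<lambda>j\<in>{..<N}. incr t h j \<omega>')" for \<omega> \<omega>'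
    by (auto simp: \<Psi>_def X_def Y_def \<tau>_def incr_def restrict_def intro!: arg_cong[where f=\<psi>])
  interpret X: prob_space "distr M ?P X" by (rule prob_space_distr) simp
  interpret Y: prob_space "distr M ?Q Y" by (rule prob_space_distr) simp
  interpret XY: pair_prob_space "distr M ?P X" "distr M ?Q Y" ..
  have int: "integrable (distr M ?P X \<Otimes>\<^sub>M distr M ?Q Y) \<Psi>"
    by (rule XY.P.integrable_const_bound[where B=C]) (auto simp: \<Psi>_def bd intro!: AE_I2)
  have "expectation (\<lambda>\<omega>. \<Psi> (X \<omega>, Y \<omega>)) = (\<integral>x. \<Psi> x \<partial>(distr M ?P X \<Otimes>\<^sub>M distr M ?Q Y))"
    unfolding joint by (subst integral_distr) auto
  also have "\<dots> = (\<integral>a. (\<integral>b. \<Psi> (a, b) \<partial>distr M ?Q Y) \<partial>distr M ?P X)"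
    by (rule XY.integral_fst'[OF int, symmetric])
  also have "\<dots> = (\<integral>a. (\<integral>\<omega>'. \<Psi> (a, Y \<omega>') \<partial>M) \<partial>distr M ?P X)"
    by (intro Bochner_Integration.integral_cong refl integral_distr) (auto simp: space_PiM)
  also have "\<dots> = expectation (\<lambda>\<omega>. expectation (\<lambda>\<omega>'. \<Psi> (X \<omega>, Y \<omega>')))"
    by (subst integral_distr) auto
  finally show ?thesis unfolding eq .
qed

definition riemann_sum where
  "riemann_sum t h N \<omega> = (\<chi> i. h * (\<Sum>j<N. exp (- 2 * (\<alpha> i \<bullet> (B (t + real j * h) \<omega> - B t \<omega>)))))" for N :: nat

text \<open>The Riemann sum as a function of the increments of \<open>W\<close> on the mesh; the drift is restored by the
  deterministic summand.\<close>

definition increment_sum where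
  "increment_sum h N D = (\<chi> i. h * (\<Sum>j<N. exp (- 2 * (\<alpha> i \<bullet> ((\<Sum>k<j. D k) + (real j * h) *\<^sub>R \<mu>)))))" for N :: nat

lemma riemann_sum_eq_increment_sum: "riemann_sum t h N \<omega> = increment_sum h N (\<lambda>j\<in>{..<N}. incr t h j \<omega>)"
proof -
  have "(\<Sum>k<j. (\<lambda>j\<in>{..<N}. incr t h j \<omega>) k) + (real j * h) *\<^sub>R \<mu> = B (t + real j * h) \<omega> - B t \<omega>" if "j < N" for j
  proof -
    have "(\<Sum>k<j. (\<lambda>j\<in>{..<N}. incr t h j \<omega>) k) = (\<Sum>k<j. incr t h k \<omega>)"
      using that by (intro sum.cong) auto
    also have "\<dots> = W (t + real j * h) \<omega> - W t \<omega>"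
      unfolding incr_def using sum_lessThan_telescope[of "\<lambda>k. W (t + real k * h) \<omega>" j] by simp
    finally show ?thesis by (simp add: W_def scaleR_left_distrib)
  qed
  then show ?thesis
    unfolding riemann_sum_def increment_sum_def by (simp cong: sum.cong_simp)
qed

lemma increment_sum_measurable[measurable]: "increment_sum h N \<in> Pi\<^sub>M {..<N} (\<lambda>_. borel) \<rightarrow>\<^sub>M borel"
proof -
  have "(\<lambda>D. \<Sum>k<j. D k) \<in> Pi\<^sub>M {..<N} (\<lambda>_. borel :: (real^'n) measure) \<rightarrow>\<^sub>M borel" if "j < N" for j
    using that by (intro borel_measurable_sum measurable_component_singleton) auto
  then have "(\<lambda>D. h * (\<Sum>j<N. exp (- 2 * (\<alpha> i \<bullet> ((\<Sum>k<j. D k) + (real j * h) *\<^sub>R \<mu>)))))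
     \<in> Pi\<^sub>M {..<N} (\<lambda>_. borel) \<rightarrow>\<^sub>M borel" for i
    by (intro borel_measurable_times borel_measurable_const borel_measurable_sum
      borel_measurable_exp[THEN measurable_compose[rotated]] borel_measurable_inner borel_measurable_add) auto
  then show ?thesis
    unfolding increment_sum_def[abs_def] by (intro borel_measurable_vec_lambda)
qed

lemma riemann_sum_measurable:
  assumes "0 \<le> t" "0 \<le> h" shows "riemann_sum t h N \<in> borel_measurable M"
proof -
  have "(\<lambda>\<omega>. \<lambda>j\<in>{..<N}. incr t h j \<omega>) \<in> M \<rightarrow>\<^sub>M Pi\<^sub>M {..<N} (\<lambda>_. borel)"
    using assms by (intro measurable_restrict incr_measurable)
  from measurable_compose[OF this increment_sum_measurable] show ?thesis
    unfolding riemann_sum_eq_increment_sum[abs_def] .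
qed

text \<open>The pair of \<open>W t - W 0\<close> and \<open>Y'\<close> has the law of a pair of independent vectors distributed like
  \<open>W t - W 0\<close> and \<open>Y\<close>. Testing against bounded continuous functions makes the relation stable under
  almost sure limits.\<close>

definition renewed where
  "renewed t Y Y' \<longleftrightarrow> (\<forall>\<psi> C. continuous_on UNIV (\<psi> :: (real ^ 'n) \<times> (real ^ 'd) \<Rightarrow> real) \<longrightarrow> (\<forall>x. \<bar>\<psi> x\<bar> \<le> C) \<longrightarrow>
     expectation (\<lambda>\<omega>. \<psi> (W t \<omega> - W 0 \<omega>, Y' \<omega>))
      = expectation (\<lambda>\<omega>. expectation (\<lambda>\<omega>'. \<psi> (W t \<omega> - W 0 \<omega>, Y \<omega>'))))"

lemma renewed_riemann_sum:
  assumes t: "0 \<le> t" and h: "0 < h" and N: "0 < N"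
  shows "renewed t (riemann_sum 0 h N) (riemann_sum t h N)"
  unfolding renewed_def
proof (intro allI impI)
  fix \<psi> :: "(real ^ 'n) \<times> (real ^ 'd) \<Rightarrow> real" and C
  assume cont: "continuous_on UNIV \<psi>" and bd: "\<forall>x. \<bar>\<psi> x\<bar> \<le> C"
  have [measurable]: "\<psi> \<in> borel_measurable (borel \<Otimes>\<^sub>M borel)"
    unfolding borel_prod using cont by (rule borel_measurable_continuous_onI)
  let ?I = "\<lambda>t \<omega>. \<lambda>j\<in>{..<N}. incr t h j \<omega>"
  have I: "?I s \<in> M \<rightarrow>\<^sub>M Pi\<^sub>M {..<N} (\<lambda>_. borel)" if "0 \<le> s" for s
    using that h by (intro measurable_restrict incr_measurable) auto
  have law: "expectation (\<lambda>\<omega>'. \<psi> (x, increment_sum h N (?I s \<omega>'))) =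
      (\<integral>d. \<psi> (x, increment_sum h N d) \<partial>Pi\<^sub>M {..<N} (\<lambda>_. density lborel (\<lambda>x::real^'n. ennreal (gauss h x))))" if "0 \<le> s" for s x
    unfolding incr_law[OF that h N, symmetric] using I[OF that] by (subst integral_distr) auto
  have m: "(\<lambda>z. \<psi> (fst z, increment_sum h N (snd z))) \<in> borel_measurable (borel \<Otimes>\<^sub>M Pi\<^sub>M {..<N} (\<lambda>_. borel))"
    by measurable
  have "expectation (\<lambda>\<omega>. \<psi> (W t \<omega> - W 0 \<omega>, increment_sum h N (?I t \<omega>)))
      = expectation (\<lambda>\<omega>. expectation (\<lambda>\<omega>'. \<psi> (W t \<omega> - W 0 \<omega>, increment_sum h N (?I t \<omega>'))))"
    using incr_indep[OF t h m, of C] bd by simp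
  also have "\<dots> = expectation (\<lambda>\<omega>. expectation (\<lambda>\<omega>'. \<psi> (W t \<omega> - W 0 \<omega>, increment_sum h N (?I 0 \<omega>'))))"
    unfolding law[OF t] law[OF order_refl] ..
  finally show "expectation (\<lambda>\<omega>. \<psi> (W t \<omega> - W 0 \<omega>, riemann_sum t h N \<omega>))
      = expectation (\<lambda>\<omega>. expectation (\<lambda>\<omega>'. \<psi> (W t \<omega> - W 0 \<omega>, riemann_sum 0 h N \<omega>')))"
    unfolding riemann_sum_eq_increment_sum .
qed

lemma renewed_limit:
  assumes t: "0 \<le> t" and ren: "\<And>k. renewed t (Y k) (Y' k)"
    and [measurable]: "\<And>k. Y k \<in> borel_measurable M" "\<And>k. Y' k \<in> borel_measurable M"
      "Z \<in> borel_measurable M" "Z' \<in> borel_measurable M"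
    and lim: "AE \<omega> in M. (\<lambda>k. Y k \<omega>) \<longlonglongrightarrow> Z \<omega>" and lim': "AE \<omega> in M. (\<lambda>k. Y' k \<omega>) \<longlonglongrightarrow> Z' \<omega>"
  shows "renewed t Z Z'"
  unfolding renewed_def
proof (intro allI impI)
  fix \<psi> :: "(real ^ 'n) \<times> (real ^ 'd) \<Rightarrow> real" and C
  assume cont: "continuous_on UNIV \<psi>" and bd: "\<forall>x. \<bar>\<psi> x\<bar> \<le> C"
  have [measurable]: "\<psi> \<in> borel_measurable (borel \<Otimes>\<^sub>M borel)"
    unfolding borel_prod using cont by (rule borel_measurable_continuous_onI)
  have [measurable]: "W t \<in> borel_measurable M" "W 0 \<in> borel_measurable M" using t by simp_all
  have C: "0 \<le> C" using bd[rule_format, of undefined] by linarith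
  have \<psi>lim: "(\<lambda>k. \<psi> (x, y k)) \<longlonglongrightarrow> \<psi> (x, z)" if "y \<longlonglongrightarrow> z" for x y z
    by (rule continuous_on_tendsto_compose[OF cont]) (auto intro: tendsto_Pair that)
  have inner: "(\<lambda>k. expectation (\<lambda>\<omega>'. \<psi> (x, Y k \<omega>'))) \<longlonglongrightarrow> expectation (\<lambda>\<omega>'. \<psi> (x, Z \<omega>'))" for x
  proof (rule integral_dominated_convergence[where w="\<lambda>_. C"])
    show "AE \<omega> in M. (\<lambda>k. \<psi> (x, Y k \<omega>)) \<longlonglongrightarrow> \<psi> (x, Z \<omega>)"
      using lim by eventually_elim (rule \<psi>lim)
  qed (use bd in auto)
  have inner_bd: "\<bar>expectation (\<lambda>\<omega>'. \<psi> (x, V \<omega>'))\<bar> \<le> C" if [measurable]: "V \<in> borel_measurable M" for x V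
  proof -
    have "\<bar>expectation (\<lambda>\<omega>'. \<psi> (x, V \<omega>'))\<bar> \<le> expectation (\<lambda>\<omega>'. \<bar>\<psi> (x, V \<omega>')\<bar>)"
      using integral_norm_bound[of M "\<lambda>\<omega>'. \<psi> (x, V \<omega>')"] by simp
    also have "\<dots> \<le> expectation (\<lambda>\<omega>'. C)"
      using bd by (intro integral_mono integrable_const integrable_const_bound[where B=C]) auto
    finally show ?thesis by (simp add: prob_space)
  qed
  have lim1: "(\<lambda>k. expectation (\<lambda>\<omega>. expectation (\<lambda>\<omega>'. \<psi> (W t \<omega> - W 0 \<omega>, Y k \<omega>')))) \<longlonglongrightarrow>
     expectation (\<lambda>\<omega>. expectation (\<lambda>\<omega>'. \<psi> (W t \<omega> - W 0 \<omega>, Z \<omega>')))"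
    by (rule integral_dominated_convergence[where w="\<lambda>_. C"]) (auto intro!: inner inner_bd)
  have lim2: "(\<lambda>k. expectation (\<lambda>\<omega>. \<psi> (W t \<omega> - W 0 \<omega>, Y' k \<omega>))) \<longlonglongrightarrow> expectation (\<lambda>\<omega>. \<psi> (W t \<omega> - W 0 \<omega>, Z' \<omega>))"
  proof (rule integral_dominated_convergence[where w="\<lambda>_. C"])
    show "AE \<omega> in M. (\<lambda>k. \<psi> (W t \<omega> - W 0 \<omega>, Y' k \<omega>)) \<longlonglongrightarrow> \<psi> (W t \<omega> - W 0 \<omega>, Z' \<omega>)"
      using lim' by eventually_elim (rule \<psi>lim)
  qed (use bd in auto)
  note ren_eq = ren[unfolded renewed_def, rule_format, OF cont bd[rule_format]]
  show "expectation (\<lambda>\<omega>. \<psi> (W t \<omega> - W 0 \<omega>, Z' \<omega>))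
      = expectation (\<lambda>\<omega>. expectation (\<lambda>\<omega>'. \<psi> (W t \<omega> - W 0 \<omega>, Z \<omega>')))"
    by (rule LIMSEQ_unique[OF lim2[unfolded ren_eq] lim1])
qed

text \<open>The second moment of \<open>exp (- 2 \<alpha>\<^sub>i(B\<^sub>s)) - 1\<close> is explicit from the Gaussian exponential moments and
  tends to 0 with \<open>s\<close>.\<close>

lemma exp_increment_L1_small:
  assumes e: "0 < e"
  shows "\<exists>\<delta>>0. \<forall>s. 0 \<le> s \<longrightarrow> s \<le> \<delta> \<longrightarrow>
     integrable M (\<lambda>\<omega>. exp (- 2 * (\<alpha> i \<bullet> (B s \<omega> - B 0 \<omega>))) - 1) \<and>
     expectation (\<lambda>\<omega>. \<bar>exp (- 2 * (\<alpha> i \<bullet> (B s \<omega> - B 0 \<omega>))) - 1\<bar>) \<le> e"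
proof -
  define a where "a = \<alpha> i \<bullet> \<mu>"
  define b where "b = \<alpha> i \<bullet> \<alpha> i"
  define V where "V s = exp (- 4 * s * a) * exp (8 * s * b) - 2 * (exp (- 2 * s * a) * exp (2 * s * b)) + 1" for s
  have "(V \<longlongrightarrow> V 0) (at_right 0)"
    unfolding V_def by (intro tendsto_intros)
  then have "(V \<longlongrightarrow> 0) (at_right 0)" by (simp add: V_def)
  from order_tendstoD(2)[OF this, of "e\<^sup>2"] obtain \<delta> where \<delta>: "\<delta> > 0" "\<And>s. 0 < s \<Longrightarrow> s < \<delta> \<Longrightarrow> V s < e\<^sup>2"
    using e by (auto simp: eventually_at_right_field)
  show ?thesis
  proof (intro exI[of _ "\<delta> / 2"] conjI allI impI)
    show "0 < \<delta> / 2" using \<delta> by simp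
    fix s :: real assume s: "0 \<le> s" "s \<le> \<delta> / 2"
    let ?u = "\<lambda>\<omega>. exp (- 2 * (\<alpha> i \<bullet> (B s \<omega> - B 0 \<omega>))) - 1"
    have "integrable M ?u \<and> expectation (\<lambda>\<omega>. \<bar>?u \<omega>\<bar>) \<le> e"
    proof (cases "s = 0")
      case True then show ?thesis using e by simp
    next
      case False
      then have s0: "0 < s" using s by simp
      define E where "E c x = exp (- c * s * a) * exp (((- c) *\<^sub>R \<alpha> i) \<bullet> x)" for c x
      have hE: "has_bochner_integral lborel (\<lambda>x. gauss s x * E c x) (exp (- c * s * a) * exp (s * c\<^sup>2 * b / 2))" for c
        using has_bochner_integral_mult_right[OF has_bochner_integral_gauss_exp[OF s0, of "(- c) *\<^sub>R \<alpha> i"], of "exp (- c * s * a)"]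
        by (simp add: E_def b_def mult_ac power2_eq_square)
      have u: "?u \<omega> = E 2 (W s \<omega> - W 0 \<omega>) - 1" for \<omega>
        by (simp add: E_def W_def a_def inner_diff_right algebra_simps flip: exp_add)
      have E4: "(E 2 x)\<^sup>2 = E 4 x" for x
        by (simp add: E_def power_mult_distrib flip: exp_of_nat_mult)
      have [measurable]: "E c \<in> borel_measurable borel" for c
        unfolding E_def[abs_def] by measurable
      have g: "has_bochner_integral lborel (gauss s :: real^'n \<Rightarrow> real) 1"
        by (rule has_bochner_integral_gauss[OF s0])
      have i2: "integrable M (\<lambda>\<omega>. E 2 (W s \<omega> - W 0 \<omega>))"
        using W_increment_integral(2)[of 0 s "E 2"] s0 hE[of 2] by (simp add: has_bochner_integral_iff)
      have sq: "has_bochner_integral lborel (\<lambda>x. gauss s x * (E 2 x - 1)\<^sup>2) (V s)"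
      proof -
        have "has_bochner_integral lborel (\<lambda>x. gauss s x * E 4 x - 2 * (gauss s x * E 2 x) + gauss s x)
           (exp (- 4 * s * a) * exp (s * 4\<^sup>2 * b / 2) - 2 * (exp (- 2 * s * a) * exp (s * 2\<^sup>2 * b / 2)) + 1)"
          by (intro has_bochner_integral_add has_bochner_integral_diff has_bochner_integral_mult_right hE g)
        moreover have "gauss s x * (E 2 x - 1)\<^sup>2 = gauss s x * E 4 x - 2 * (gauss s x * E 2 x) + gauss s x" for x
          unfolding E4[symmetric] by (simp add: power2_eq_square algebra_simps)
        ultimately show ?thesis by (simp add: V_def mult_ac)
      qed
      have isq: "integrable M (\<lambda>\<omega>. (?u \<omega>)\<^sup>2)" and vsq: "expectation (\<lambda>\<omega>. (?u \<omega>)\<^sup>2) = V s"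
        using W_increment_integral[of 0 s "\<lambda>x. (E 2 x - 1)\<^sup>2"] s0 sq unfolding u by (simp_all add: has_bochner_integral_iff)
      have iu: "integrable M ?u" unfolding u using i2 by auto
      have "expectation (\<lambda>\<omega>. \<bar>?u \<omega>\<bar>) \<le> expectation (\<lambda>\<omega>. e / 2 + (?u \<omega>)\<^sup>2 / (2 * e))"
      proof (intro integral_mono)
        show "integrable M (\<lambda>\<omega>. \<bar>?u \<omega>\<bar>)" using iu by (rule integrable_abs)
        show "integrable M (\<lambda>\<omega>. e / 2 + (?u \<omega>)\<^sup>2 / (2 * e))" using isq by auto
        fix \<omega>
        \<comment> \<open>Young's inequality trades the first moment for the second.\<close>
        have "0 \<le> (\<bar>?u \<omega>\<bar> - e)\<^sup>2" by simp
        then show "\<bar>?u \<omega>\<bar> \<le> e / 2 + (?u \<omega>)\<^sup>2 / (2 * e)"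
          using e by (simp add: power2_diff field_simps power2_eq_square)
      qed
      also have "\<dots> = e / 2 + V s / (2 * e)"
        using isq vsq by (simp add: prob_space)
      also have "\<dots> \<le> e"
        using \<delta>(2)[of s] s s0 \<delta>(1) e by (simp add: field_simps power2_eq_square)
      finally show ?thesis using iu by simp
    qed
    then show "integrable M ?u" "expectation (\<lambda>\<omega>. \<bar>?u \<omega>\<bar>) \<le> e" by auto
  qed
qed

text \<open>The bound is uniform in the mesh, so it survives the passage to the integral over \<open>[0, t]\<close>.\<close>

lemma riemann_sum_near_t:
  assumes e: "0 < e"
  shows "\<exists>\<delta>>0. \<forall>t m. 0 < t \<longrightarrow> t \<le> \<delta> \<longrightarrow>
     integrable M (\<lambda>\<omega>. riemann_sum 0 (t / real (Suc m)) (Suc m) \<omega> - (\<chi> i. t)) \<and>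
     expectation (\<lambda>\<omega>. norm (riemann_sum 0 (t / real (Suc m)) (Suc m) \<omega> - (\<chi> i. t))) \<le> e * t"
proof -
  define d where "d = real CARD('d)"
  have d: "0 < d" by (simp add: d_def)
  have "\<forall>i. \<exists>\<delta>>0. \<forall>s. 0 \<le> s \<longrightarrow> s \<le> \<delta> \<longrightarrow>
     integrable M (\<lambda>\<omega>. exp (- 2 * (\<alpha> i \<bullet> (B s \<omega> - B 0 \<omega>))) - 1) \<and>
     expectation (\<lambda>\<omega>. \<bar>exp (- 2 * (\<alpha> i \<bullet> (B s \<omega> - B 0 \<omega>))) - 1\<bar>) \<le> e / d"
    using e d by (intro allI exp_increment_L1_small) auto
  from choice[OF this] obtain \<Delta> where D: "\<forall>i. \<Delta> i > 0 \<and> (\<forall>s. 0 \<le> s \<longrightarrow> s \<le> \<Delta> i \<longrightarrow>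
     integrable M (\<lambda>\<omega>. exp (- 2 * (\<alpha> i \<bullet> (B s \<omega> - B 0 \<omega>))) - 1) \<and>
     expectation (\<lambda>\<omega>. \<bar>exp (- 2 * (\<alpha> i \<bullet> (B s \<omega> - B 0 \<omega>))) - 1\<bar>) \<le> e / d)" ..
  have \<Delta>: "\<Delta> i > 0" for i
    using D[rule_format, of i] by (rule conjunct1)
  note D2 = D[rule_format, THEN conjunct2, rule_format]
  define \<delta> where "\<delta> = Min (range \<Delta>)"
  have \<delta>: "0 < \<delta>" "\<And>i. \<delta> \<le> \<Delta> i" using \<Delta> by (auto simp: \<delta>_def)
  show ?thesis
  proof (intro exI[of _ \<delta>] conjI allI impI \<delta>(1))
    fix t :: real and m :: nat assume t: "0 < t" "t \<le> \<delta>"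
    define N where "N = Suc m"
    define h where "h = t / real N"
    have h: "0 < h" "real N * h = t" using t by (simp_all add: h_def N_def)
    define U where "U i j \<omega> = exp (- 2 * (\<alpha> i \<bullet> (B (real j * h) \<omega> - B 0 \<omega>))) - 1" for i j \<omega>
    have jh: "0 \<le> real j * h" "real j * h \<le> \<Delta> i" if "j < N" for j i
    proof -
      have "real j * h \<le> real N * h" using that h by (intro mult_right_mono) auto
      then show "real j * h \<le> \<Delta> i" using h t \<delta>(2)[of i] by simp
    qed (use h in simp)
    have U: "integrable M (U i j)" "expectation (\<lambda>\<omega>. \<bar>U i j \<omega>\<bar>) \<le> e / d" if "j < N" for i j
      unfolding U_def[abs_def] by (rule D2[OF jh[OF that], THEN conjunct1], rule D2[OF jh[OF that], THEN conjunct2])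
    have comp: "(riemann_sum 0 h N \<omega> - (\<chi> i. t)) $ i = h * (\<Sum>j<N. U i j \<omega>)" for i \<omega>
      unfolding h(2)[symmetric] by (simp add: riemann_sum_def U_def sum_subtractf algebra_simps)
    have int_c: "integrable M (\<lambda>\<omega>. (riemann_sum 0 h N \<omega> - (\<chi> i. t)) $ i)" for i
      unfolding comp by (intro integrable_mult_right Bochner_Integration.integrable_sum U) auto
    have rep: "riemann_sum 0 h N \<omega> - (\<chi> i. t) = (\<Sum>i\<in>UNIV. (riemann_sum 0 h N \<omega> - (\<chi> i. t)) $ i *\<^sub>R axis i 1)" for \<omega>
      by (simp add: vec_eq_iff sum_axis_nth)
    have "integrable M (\<lambda>\<omega>. \<Sum>i\<in>UNIV. (riemann_sum 0 h N \<omega> - (\<chi> i. t)) $ i *\<^sub>R axis i (1::real))"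
      by (intro Bochner_Integration.integrable_sum integrable_scaleR_left int_c)
    then have int_v: "integrable M (\<lambda>\<omega>. riemann_sum 0 h N \<omega> - (\<chi> i. t))"
      unfolding rep[symmetric] .
    have "expectation (\<lambda>\<omega>. norm (riemann_sum 0 h N \<omega> - (\<chi> i. t))) \<le> expectation (\<lambda>\<omega>. \<Sum>i\<in>UNIV. h * (\<Sum>j<N. \<bar>U i j \<omega>\<bar>))"
    proof (intro integral_mono)
      show "integrable M (\<lambda>\<omega>. norm (riemann_sum 0 h N \<omega> - (\<chi> i. t)))" using int_v by (rule integrable_norm)
      show "integrable M (\<lambda>\<omega>. \<Sum>i\<in>UNIV. h * (\<Sum>j<N. \<bar>U i j \<omega>\<bar>))"
        by (intro Bochner_Integration.integrable_sum integrable_mult_right integrable_abs U) auto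
      fix \<omega>
      have "norm (riemann_sum 0 h N \<omega> - (\<chi> i. t)) \<le> (\<Sum>i\<in>UNIV. \<bar>(riemann_sum 0 h N \<omega> - (\<chi> i. t)) $ i\<bar>)"
        by (rule norm_le_l1_cart)
      also have "\<dots> \<le> (\<Sum>i\<in>UNIV. h * (\<Sum>j<N. \<bar>U i j \<omega>\<bar>))"
        unfolding comp using h by (intro sum_mono) (simp add: abs_mult sum_abs)
      finally show "norm (riemann_sum 0 h N \<omega> - (\<chi> i. t)) \<le> (\<Sum>i\<in>UNIV. h * (\<Sum>j<N. \<bar>U i j \<omega>\<bar>))" .
    qed
    also have "\<dots> = (\<Sum>i\<in>UNIV. h * (\<Sum>j<N. expectation (\<lambda>\<omega>. \<bar>U i j \<omega>\<bar>)))"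
    proof -
      have *: "expectation (\<lambda>\<omega>. h * (\<Sum>j<N. \<bar>U i j \<omega>\<bar>)) = h * (\<Sum>j<N. expectation (\<lambda>\<omega>. \<bar>U i j \<omega>\<bar>))" for i
        unfolding integral_mult_right_zero
        by (subst Bochner_Integration.integral_sum) (auto intro!: integrable_abs U)
      show ?thesis
        unfolding *[symmetric]
        by (rule Bochner_Integration.integral_sum)
          (auto intro!: Bochner_Integration.integrable_sum integrable_mult_right integrable_abs U)
    qed
    also have "\<dots> \<le> (\<Sum>i\<in>(UNIV::'d set). h * (\<Sum>j<N. e / d))"
      using h U(2) by (intro sum_mono mult_left_mono) auto
    also have "\<dots> = e * t"
      using d h(2) by (simp add: d_def mult_ac)
    finally show "expectation (\<lambda>\<omega>. norm (riemann_sum 0 (t / real (Suc m)) (Suc m) \<omega> - (\<chi> i. t))) \<le> e * t"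
      by (simp add: h_def N_def)
    show "integrable M (\<lambda>\<omega>. riemann_sum 0 (t / real (Suc m)) (Suc m) \<omega> - (\<chi> i. t))"
      using int_v by (simp add: h_def N_def)
  qed
qed

end

section \<open>The exponential functional\<close>

locale exponential_functional = drifted_bm M B \<mu> \<alpha>
  for M :: "'w measure" and B :: "real \<Rightarrow> 'w \<Rightarrow> real ^ 'n::finite" and \<mu> :: "real ^ 'n"
    and \<alpha> :: "'d::finite \<Rightarrow> real ^ 'n" +
  fixes p :: "real ^ 'd \<Rightarrow> real"
  assumes dens: "distributed M lborel (A_infinity \<alpha> B) (\<lambda>y. ennreal (p y))"
    and p_nonneg: "\<And>y. 0 \<le> p y"
begin

abbreviation "A \<equiv> A_infinity \<alpha> B"

definition integrand where "integrand \<omega> i s = exp (- 2 * (\<alpha> i \<bullet> B s \<omega>))"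

lemma A_measurable[measurable]: "A \<in> borel_measurable M"
  using distributed_measurable[OF dens] by simp

lemma p_measurable[measurable]: "p \<in> borel_measurable borel"
  using distributed_real_measurable[OF _ dens] p_nonneg by simp

lemma A_expectation:
  fixes g :: "real ^ 'd \<Rightarrow> real"
  assumes "g \<in> borel_measurable borel"
  shows "expectation (\<lambda>\<omega>. g (A \<omega>)) = (\<integral>y. p y * g y \<partial>lborel)"
  using distributed_integral[OF dens, of g] assms p_nonneg by simp

lemma p_integral: "has_bochner_integral lborel p 1"
proof -
  have "integrable lborel (\<lambda>y. p y * 1)"
    using distributed_integrable[OF dens, of "\<lambda>_. 1"] p_nonneg by simp
  moreover have "(\<integral>y. p y * 1 \<partial>lborel) = 1"
    using A_expectation[of "\<lambda>_. 1"] by (simp add: prob_space)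
  ultimately show ?thesis by (simp add: has_bochner_integral_iff)
qed

text \<open>A divergent integral is 0 by convention, and a vector with a Lebesgue density almost surely has no
  vanishing coordinate.\<close>

lemma AE_convergent: "AE \<omega> in M. \<forall>i. set_integrable lborel {0..} (integrand \<omega> i)"
proof -
  have nz: "AE \<omega> in M. A \<omega> $ i \<noteq> 0" for i
  proof -
    have "AE y in lborel. y \<bullet> axis i (1::real) \<noteq> 0"
      by (rule AE_lborel_inner_neq) (simp add: Basis_vec_eq_range)
    then have "AE y in lborel. 0 < ennreal (p y) \<longrightarrow> y $ i \<noteq> 0"
      by eventually_elim (simp add: inner_axis)
    then show ?thesis
      by (subst distributed_AE2[OF dens]) auto
  qed
  have "AE \<omega> in M. \<forall>i\<in>UNIV. A \<omega> $ i \<noteq> 0"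
    by (intro AE_finite_allI nz) simp
  then show ?thesis
  proof eventually_elim
    case (elim \<omega>)
    show ?case
    proof (intro allI, rule ccontr)
      fix i assume "\<not> set_integrable lborel {0..} (integrand \<omega> i)"
      then have "A \<omega> $ i = 0"
        by (simp add: A_infinity_def set_integrable_def set_lebesgue_integral_def integrand_def not_integrable_integral_eq)
      with elim show False by simp
    qed
  qed
qed

definition regular where
  "regular \<omega> \<longleftrightarrow> B 0 \<omega> = 0 \<and> continuous_on {0..} (\<lambda>s. B s \<omega>) \<and> (\<forall>i. set_integrable lborel {0..} (integrand \<omega> i))"

lemma AE_regular: "AE \<omega> in M. regular \<omega>"
  using B_start B_cont AE_convergent unfolding regular_def by eventually_elim simp

text \<open>On regular paths \<open>window t K\<close> is the functional of the path restarted at \<open>t\<close>, integrated over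
  \<open>[0, K]\<close>, and \<open>restarted t\<close> its limit over \<open>[0, \<infinity>)\<close>. Defining them as limits of Riemann sums makes
  them measurable on the whole space, although paths are continuous only almost surely.\<close>

definition window where "window t K \<omega> = lim (\<lambda>m. riemann_sum t (K / real (Suc m)) (Suc m) \<omega>)"
definition restarted where "restarted t \<omega> = lim (\<lambda>k. window t (real (Suc k)) \<omega>)"

lemma window_measurable[measurable]: "0 \<le> t \<Longrightarrow> 0 < K \<Longrightarrow> window t K \<in> borel_measurable M"
  unfolding window_def[abs_def] by (intro borel_measurable_lim_metric riemann_sum_measurable) auto

lemma restarted_measurable[measurable]: "0 \<le> t \<Longrightarrow> restarted t \<in> borel_measurable M"
  unfolding restarted_def[abs_def] by (intro borel_measurable_lim_metric window_measurable) auto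

lemma integrand_cont: "regular \<omega> \<Longrightarrow> continuous_on {0..} (integrand \<omega> i)"
  unfolding integrand_def[abs_def] regular_def by (intro continuous_intros) auto

lemma riemann_sum_tendsto:
  assumes \<omega>: "regular \<omega>" and t: "0 \<le> t" and K: "0 < K"
  shows "(\<lambda>m. riemann_sum t (K / real (Suc m)) (Suc m) \<omega>) \<longlonglongrightarrow>
    (\<chi> i. integral {0..K} (\<lambda>s. integrand \<omega> i (t + s) / integrand \<omega> i t))"
proof (rule vec_tendstoI)
  fix i
  have "continuous_on {0..K} (\<lambda>s. integrand \<omega> i (t + s))"
    by (rule continuous_on_compose2[OF integrand_cont[OF \<omega>]]) (use t in \<open>auto intro!: continuous_intros\<close>)
  then have "continuous_on {0..K} (\<lambda>s. integrand \<omega> i (t + s) / integrand \<omega> i t)"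
    by (intro continuous_intros) (auto simp: integrand_def)
  from left_Riemann_sum_tendsto[OF K this]
  show "(\<lambda>m. riemann_sum t (K / real (Suc m)) (Suc m) \<omega> $ i) \<longlonglongrightarrow>
     (\<chi> i. integral {0..K} (\<lambda>s. integrand \<omega> i (t + s) / integrand \<omega> i t)) $ i"
    by (simp add: riemann_sum_def integrand_def inner_diff_right algebra_simps flip: exp_diff)
qed

lemma window_eq:
  assumes "regular \<omega>" "0 \<le> t" "0 < K"
  shows "window t K \<omega> = (\<chi> i. integral {0..K} (\<lambda>s. integrand \<omega> i (t + s)) / integrand \<omega> i t)"
  using limI[OF riemann_sum_tendsto[OF assms]] by (simp add: window_def)

lemma window_tendsto:
  assumes \<omega>: "regular \<omega>" and t: "0 \<le> t"
  shows "(\<lambda>k. window t (real (Suc k)) \<omega>) \<longlonglongrightarrow> (\<chi> i. (A \<omega> $ i - integral {0..t} (integrand \<omega> i)) / integrand \<omega> i t)"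
proof (rule vec_tendstoI)
  fix i
  have "(\<lambda>k. integral {0..real (Suc k)} (\<lambda>s. integrand \<omega> i (t + s))) \<longlonglongrightarrow> (LINT s:{0..}|lborel. integrand \<omega> i s) - integral {0..t} (integrand \<omega> i)"
    using \<omega> t by (intro integral_tail_tendsto integrand_cont) (auto simp: regular_def)
  then have "(\<lambda>k. integral {0..real (Suc k)} (\<lambda>s. integrand \<omega> i (t + s)) / integrand \<omega> i t) \<longlonglongrightarrow> (A \<omega> $ i - integral {0..t} (integrand \<omega> i)) / integrand \<omega> i t"
    by (intro tendsto_divide tendsto_const) (simp_all add: A_infinity_def integrand_def[abs_def])
  then show "(\<lambda>k. window t (real (Suc k)) \<omega> $ i) \<longlonglongrightarrow> (\<chi> i. (A \<omega> $ i - integral {0..t} (integrand \<omega> i)) / integrand \<omega> i t) $ i"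
    using window_eq[OF \<omega> t] by simp
qed

lemma restarted_eq:
  assumes "regular \<omega>" "0 \<le> t"
  shows "restarted t \<omega> = (\<chi> i. (A \<omega> $ i - integral {0..t} (integrand \<omega> i)) / integrand \<omega> i t)"
  using limI[OF window_tendsto[OF assms]] by (simp add: restarted_def)

lemma restarted_0: "regular \<omega> \<Longrightarrow> restarted 0 \<omega> = A \<omega>"
proof -
  assume \<omega>: "regular \<omega>"
  then have "integrand \<omega> i 0 = 1" for i by (simp add: integrand_def regular_def)
  then show ?thesis using restarted_eq[OF \<omega> order_refl] by (simp add: vec_eq_iff)
qed

text \<open>The path is cut at time \<open>t\<close>; \<open>window 0 t\<close> is the contribution of \<open>[0, t]\<close>.\<close>

lemma A_decomposition:
  assumes \<omega>: "regular \<omega>" and t: "0 < t"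
  shows "A \<omega> = window 0 t \<omega> + (\<chi> i. integrand \<omega> i t * restarted t \<omega> $ i)"
proof -
  have "integrand \<omega> i 0 = 1" "integrand \<omega> i t \<noteq> 0" for i using \<omega> by (simp_all add: integrand_def regular_def)
  then show ?thesis
    using window_eq[OF \<omega> order_refl t] restarted_eq[OF \<omega> less_imp_le[OF t]] by (simp add: vec_eq_iff)
qed

lemma renewed_A:
  assumes t: "0 \<le> t"
  shows "renewed t A (restarted t)"
proof -
  have L: "renewed t (window 0 K) (window t K)" if K: "0 < K" for K
  proof (rule renewed_limit[OF t])
    show "renewed t (riemann_sum 0 (K / real (Suc m)) (Suc m)) (riemann_sum t (K / real (Suc m)) (Suc m))" for m
      using t K by (intro renewed_riemann_sum) auto
    have "AE \<omega> in M. (\<lambda>m. riemann_sum s (K / real (Suc m)) (Suc m) \<omega>) \<longlonglongrightarrow> window s K \<omega>" if "0 \<le> s" for s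
      using AE_regular
    proof eventually_elim
      case (elim \<omega>)
      then show ?case using riemann_sum_tendsto[OF elim that K] limI[OF riemann_sum_tendsto[OF elim that K]] by (simp add: window_def)
    qed
    from this[OF order_refl] this[OF t]
    show "AE \<omega> in M. (\<lambda>m. riemann_sum 0 (K / real (Suc m)) (Suc m) \<omega>) \<longlonglongrightarrow> window 0 K \<omega>"
      "AE \<omega> in M. (\<lambda>m. riemann_sum t (K / real (Suc m)) (Suc m) \<omega>) \<longlonglongrightarrow> window t K \<omega>" .
  qed (use t K in \<open>auto intro!: riemann_sum_measurable window_measurable\<close>)
  show ?thesis
  proof (rule renewed_limit[OF t])
    show "renewed t (window 0 (real (Suc k))) (window t (real (Suc k)))" for k
      by (rule L) simp
    have "AE \<omega> in M. (\<lambda>k. window s (real (Suc k)) \<omega>) \<longlonglongrightarrow> restarted s \<omega>" if "0 \<le> s" for s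
      using AE_regular by eventually_elim (simp add: window_tendsto that restarted_eq del: of_nat_Suc)
    note lim = this
    show "AE \<omega> in M. (\<lambda>k. window 0 (real (Suc k)) \<omega>) \<longlonglongrightarrow> A \<omega>"
      using AE_regular lim[OF order_refl] by eventually_elim (simp add: restarted_0 del: of_nat_Suc)
    show "AE \<omega> in M. (\<lambda>k. window t (real (Suc k)) \<omega>) \<longlonglongrightarrow> restarted t \<omega>"
      by (rule lim[OF t])
  qed (use t in \<open>auto intro!: window_measurable restarted_measurable\<close>)
qed

lemma renewed_expectation:
  assumes t: "0 < t" and cont: "continuous_on UNIV \<psi>" and bd: "\<And>x. \<bar>\<psi> x\<bar> \<le> C"
  shows "expectation (\<lambda>\<omega>. \<psi> (W t \<omega> - W 0 \<omega>, restarted t \<omega>))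
    = (\<integral>x. gauss t x * (\<integral>y. p y * \<psi> (x, y) \<partial>lborel) \<partial>lborel)"
proof -
  have [measurable]: "\<psi> \<in> borel_measurable (borel \<Otimes>\<^sub>M borel)"
    unfolding borel_prod using cont by (rule borel_measurable_continuous_onI)
  have "expectation (\<lambda>\<omega>. \<psi> (W t \<omega> - W 0 \<omega>, restarted t \<omega>))
      = expectation (\<lambda>\<omega>. expectation (\<lambda>\<omega>'. \<psi> (W t \<omega> - W 0 \<omega>, A \<omega>')))"
    using renewed_A[OF less_imp_le[OF t], unfolded renewed_def, rule_format, OF cont bd] .
  also have "\<dots> = expectation (\<lambda>\<omega>. (\<lambda>x. \<integral>y. p y * \<psi> (x, y) \<partial>lborel) (W t \<omega> - W 0 \<omega>))"
  proof -
    have "expectation (\<lambda>\<omega>'. \<psi> (x, A \<omega>')) = (\<integral>y. p y * \<psi> (x, y) \<partial>lborel)" for x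
      by (rule A_expectation) measurable
    then show ?thesis by simp
  qed
  also have "\<dots> = (\<integral>x. gauss t x * (\<integral>y. p y * \<psi> (x, y) \<partial>lborel) \<partial>lborel)"
    by (subst W_increment_integral(1)) (use t in auto)
  finally show ?thesis .
qed

text \<open>By the decomposition at time \<open>t\<close> and the Lipschitz property, replacing the integral over \<open>[0, t]\<close>
  by \<open>t\<close> costs at most \<open>H\<close> times its \<open>L\<^sup>1\<close> distance to \<open>t\<close>, which is \<open>o(t)\<close>. After the replacement
  only the joint law of \<open>B\<^sub>t\<close> and the restarted functional matters, and that is a product.\<close>

lemma short_time_estimate:
  fixes f :: "real ^ 'd \<Rightarrow> real"
  assumes lip: "\<And>x y. \<bar>f x - f y\<bar> \<le> H * norm (x - y)" and bd: "\<And>x. \<bar>f x\<bar> \<le> C" and e: "0 < e"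
  shows "\<exists>\<delta>>0. \<forall>t. 0 < t \<longrightarrow> t \<le> \<delta> \<longrightarrow>
    \<bar>(\<integral>x. gauss t x * (\<integral>y. p y * f (\<chi> i. t + exp (- 2 * (\<alpha> i \<bullet> (x + t *\<^sub>R \<mu>))) * y $ i) \<partial>lborel) \<partial>lborel)
      - (\<integral>y. p y * f y \<partial>lborel)\<bar> \<le> e * t"
proof -
  have H: "0 \<le> H"
    using lip[of "axis undefined 1" 0] by simp
  have bd2: "\<bar>f x - f y\<bar> \<le> 2 * C" for x y using bd[of x] bd[of y] by linarith
  have f_cont: "continuous_on UNIV f"
  proof -
    have "H-lipschitz_on UNIV f"
      using lip H by (intro lipschitz_onI) (auto simp: dist_norm)
    then show ?thesis by (rule lipschitz_on_continuous_on)
  qed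
  have [measurable]: "f \<in> borel_measurable borel"
    using f_cont by (rule borel_measurable_continuous_onI)
  obtain \<delta> where \<delta>: "0 < \<delta>" and
    int: "\<And>t m. 0 < t \<Longrightarrow> t \<le> \<delta> \<Longrightarrow> integrable M (\<lambda>\<omega>. riemann_sum 0 (t / real (Suc m)) (Suc m) \<omega> - (\<chi> i. t))" and
    near: "\<And>t m. 0 < t \<Longrightarrow> t \<le> \<delta> \<Longrightarrow> expectation (\<lambda>\<omega>. norm (riemann_sum 0 (t / real (Suc m)) (Suc m) \<omega> - (\<chi> i. t))) \<le> e / (H + 1) * t"
    using riemann_sum_near_t[of "e / (H + 1)"] e H by (auto simp: add_nonneg_pos)
  show ?thesis
  proof (intro exI[of _ \<delta>] conjI allI impI \<delta>)
    fix t :: real assume t: "0 < t" "t \<le> \<delta>"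
    have [measurable]: "W t \<in> borel_measurable M" "W 0 \<in> borel_measurable M" "restarted t \<in> borel_measurable M"
      "riemann_sum 0 (t / real (Suc m)) (Suc m) \<in> borel_measurable M" for m
      using t by (auto intro!: riemann_sum_measurable)
    define \<psi> where "\<psi> = (\<lambda>(x, y). f (\<chi> i. t + exp (- 2 * (\<alpha> i \<bullet> (x + t *\<^sub>R \<mu>))) * y $ i))"
    define S where "S \<omega> = (\<chi> i. exp (- 2 * (\<alpha> i \<bullet> (W t \<omega> - W 0 \<omega> + t *\<^sub>R \<mu>))) * restarted t \<omega> $ i)" for \<omega>
    have [measurable]: "S \<in> borel_measurable M"
    proof -
      have [measurable]: "(\<lambda>\<omega>. restarted t \<omega> $ i) \<in> borel_measurable M" for i
        using t by (intro measurable_compose[OF restarted_measurable]) auto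
      show ?thesis unfolding S_def[abs_def] by (intro borel_measurable_vec_lambda) measurable
    qed
    have \<psi>: "expectation (\<lambda>\<omega>. f ((\<chi> i. t) + S \<omega>)) =
       (\<integral>x. gauss t x * (\<integral>y. p y * f (\<chi> i. t + exp (- 2 * (\<alpha> i \<bullet> (x + t *\<^sub>R \<mu>))) * y $ i) \<partial>lborel) \<partial>lborel)"
    proof -
      have "continuous_on UNIV \<psi>"
        unfolding \<psi>_def split_def
        by (rule continuous_on_compose2[OF f_cont]) (auto intro!: continuous_intros continuous_on_vec_lambda)
      moreover have "\<bar>\<psi> z\<bar> \<le> C" for z using bd by (simp add: \<psi>_def split_def)
      ultimately have "expectation (\<lambda>\<omega>. \<psi> (W t \<omega> - W 0 \<omega>, restarted t \<omega>)) = (\<integral>x. gauss t x * (\<integral>y. p y * \<psi> (x, y) \<partial>lborel) \<partial>lborel)"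
        using renewed_expectation[OF t(1)] by blast
      moreover have "(\<chi> i. t) + S \<omega> = (\<chi> i. t + exp (- 2 * (\<alpha> i \<bullet> (W t \<omega> - W 0 \<omega> + t *\<^sub>R \<mu>))) * restarted t \<omega> $ i)" for \<omega>
        by (simp add: vec_eq_iff S_def)
      ultimately show ?thesis by (simp add: \<psi>_def)
    qed
    let ?riemann_sum = "\<lambda>m. riemann_sum 0 (t / real (Suc m)) (Suc m)"
    have lim: "(\<lambda>m. expectation (\<lambda>\<omega>. f (?riemann_sum m \<omega> + S \<omega>) - f ((\<chi> i. t) + S \<omega>))) \<longlonglongrightarrow>
       expectation (\<lambda>\<omega>. f (A \<omega>) - f ((\<chi> i. t) + S \<omega>))"
    proof (rule integral_dominated_convergence[where w="\<lambda>_. 2 * C"])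
      show "AE \<omega> in M. (\<lambda>m. f (?riemann_sum m \<omega> + S \<omega>) - f ((\<chi> i. t) + S \<omega>)) \<longlonglongrightarrow> f (A \<omega>) - f ((\<chi> i. t) + S \<omega>)"
        using AE_regular
      proof eventually_elim
        case (elim \<omega>)
        have "S \<omega> = (\<chi> i. integrand \<omega> i t * restarted t \<omega> $ i)"
          using elim by (simp add: S_def integrand_def W_def regular_def)
        then have A: "A \<omega> = window 0 t \<omega> + S \<omega>" using A_decomposition[OF elim t(1)] by simp
        have "(\<lambda>m. ?riemann_sum m \<omega>) \<longlonglongrightarrow> window 0 t \<omega>"
          using riemann_sum_tendsto[OF elim order_refl t(1)] limI[OF riemann_sum_tendsto[OF elim order_refl t(1)]] by (simp add: window_def)
        then have "(\<lambda>m. ?riemann_sum m \<omega> + S \<omega>) \<longlonglongrightarrow> A \<omega>" unfolding A by (intro tendsto_intros)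
        then have "(\<lambda>m. f (?riemann_sum m \<omega> + S \<omega>)) \<longlonglongrightarrow> f (A \<omega>)"
          by (intro continuous_on_tendsto_compose[OF f_cont]) auto
        then show ?case by (intro tendsto_intros)
      qed
      show "AE \<omega> in M. norm (f (?riemann_sum m \<omega> + S \<omega>) - f ((\<chi> i. t) + S \<omega>)) \<le> 2 * C" for m
        by (intro AE_I2) (simp add: bd2)
    qed (simp_all del: of_nat_Suc)
    have step: "\<bar>expectation (\<lambda>\<omega>. f (?riemann_sum m \<omega> + S \<omega>) - f ((\<chi> i. t) + S \<omega>))\<bar> \<le> e * t" for m
    proof -
      have "\<bar>expectation (\<lambda>\<omega>. f (?riemann_sum m \<omega> + S \<omega>) - f ((\<chi> i. t) + S \<omega>))\<bar>
         \<le> expectation (\<lambda>\<omega>. \<bar>f (?riemann_sum m \<omega> + S \<omega>) - f ((\<chi> i. t) + S \<omega>)\<bar>)"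
        using integral_norm_bound[of M "\<lambda>\<omega>. f (?riemann_sum m \<omega> + S \<omega>) - f ((\<chi> i. t) + S \<omega>)"] by simp
      also have "\<dots> \<le> expectation (\<lambda>\<omega>. H * norm (?riemann_sum m \<omega> - (\<chi> i. t)))"
      proof (intro integral_mono)
        show "integrable M (\<lambda>\<omega>. \<bar>f (?riemann_sum m \<omega> + S \<omega>) - f ((\<chi> i. t) + S \<omega>)\<bar>)"
          by (intro integrable_const_bound[where B="2 * C"] AE_I2) (simp_all add: bd2 del: of_nat_Suc)
        show "integrable M (\<lambda>\<omega>. H * norm (?riemann_sum m \<omega> - (\<chi> i. t)))"
          using int[OF t] by (intro integrable_mult_right integrable_norm)
        show "\<bar>f (?riemann_sum m \<omega> + S \<omega>) - f ((\<chi> i. t) + S \<omega>)\<bar> \<le> H * norm (?riemann_sum m \<omega> - (\<chi> i. t))" for \<omega>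
          using lip[of "?riemann_sum m \<omega> + S \<omega>" "(\<chi> i. t) + S \<omega>"] by simp
      qed
      also have "\<dots> = H * expectation (\<lambda>\<omega>. norm (?riemann_sum m \<omega> - (\<chi> i. t)))" by simp
      also have "\<dots> \<le> H * (e / (H + 1) * t)"
        using near[OF t] H by (rule mult_left_mono)
      also have "\<dots> = H / (H + 1) * (e * t)" by simp
      also have "\<dots> \<le> 1 * (e * t)" using H e t by (intro mult_right_mono) auto
      finally show ?thesis by simp
    qed
    have "\<bar>expectation (\<lambda>\<omega>. f (A \<omega>) - f ((\<chi> i. t) + S \<omega>))\<bar> \<le> e * t"
      by (rule LIMSEQ_le_const2[OF tendsto_rabs[OF lim]]) (use step in auto)
    moreover have "expectation (\<lambda>\<omega>. f (A \<omega>) - f ((\<chi> i. t) + S \<omega>)) =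
       expectation (\<lambda>\<omega>. f (A \<omega>)) - expectation (\<lambda>\<omega>. f ((\<chi> i. t) + S \<omega>))"
      using bd by (intro Bochner_Integration.integral_diff integrable_const_bound[where B=C]) auto
    ultimately show "\<bar>(\<integral>x. gauss t x * (\<integral>y. p y * f (\<chi> i. t + exp (- 2 * (\<alpha> i \<bullet> (x + t *\<^sub>R \<mu>))) * y $ i) \<partial>lborel) \<partial>lborel)
      - (\<integral>y. p y * f y \<partial>lborel)\<bar> \<le> e * t"
      by (simp add: \<psi> A_expectation abs_minus_commute)
  qed
qed

end

section \<open>The adjoint equation\<close>

definition bump :: "real ^ 'd \<Rightarrow> real \<Rightarrow> real ^ 'd \<Rightarrow> real" where
  "bump y r z = max 0 (r - dist z y)"

text \<open>Otherwise \<open>D\<close> has constant sign on a ball around \<open>y\<close>, and the bump supported there gives a non-zero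
  integral.\<close>

lemma continuous_eq_zero_if_orthogonal_to_bumps:
  fixes D :: "real ^ 'd::finite \<Rightarrow> real"
  assumes cont: "continuous_on UNIV D"
    and orth: "\<And>r. 0 < r \<Longrightarrow> (\<integral>z. bump y r z * D z \<partial>lborel) = 0"
  shows "D y = 0"
proof (rule ccontr)
  assume nz: "D y \<noteq> 0"
  define c where "c = sgn (D y)"
  have "0 < c * D y" using nz by (simp add: c_def sgn_if)
  moreover have "open {z. 0 < c * D z}"
    by (intro open_Collect_less continuous_intros cont)
  ultimately obtain r where r: "0 < r" "ball y r \<subseteq> {z. 0 < c * D z}"
    using openE by (metis mem_Collect_eq)
  have pos: "0 < c * D z \<and> 0 < bump y r z" if "dist z y < r" for z
  proof -
    have "z \<in> ball y r" using that by (simp add: dist_commute)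
    then show ?thesis using r(2) that by (auto simp: bump_def)
  qed
  have z0: "bump y r z = 0" if "\<not> dist z y < r" for z using that by (simp add: bump_def)
  have nonneg: "0 \<le> bump y r z * (c * D z)" for z
  proof (cases "dist z y < r")
    case True
    from pos[OF this] show ?thesis by simp
  qed (simp add: z0)
  have int: "integrable lborel (\<lambda>z. bump y r z * (c * D z))"
  proof (rule integrable_mult_compact_support[OF compact_cball[of y r]])
    show "continuous_on UNIV (bump y r)"
      unfolding bump_def[abs_def] by (intro continuous_intros)
    show "continuous_on UNIV (\<lambda>z. c * D z)" by (intro continuous_intros cont)
  qed (simp add: bump_def dist_commute)
  have "(\<integral>z. bump y r z * (c * D z) \<partial>lborel) = c * (\<integral>z. bump y r z * D z \<partial>lborel)"
    by (simp add: mult.left_commute)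
  also have "\<dots> = 0" by (simp add: orth[OF r(1)])
  finally have "AE z in lborel. bump y r z * (c * D z) = 0"
    using integral_nonneg_eq_0_iff_AE[OF int] nonneg by simp
  then have "AE z in lborel. z \<notin> ball y r"
  proof eventually_elim
    case (elim z)
    then show ?case using pos[of z] by (auto simp: dist_commute)
  qed
  then have "ball y r \<in> null_sets lborel"
    by (subst (asm) AE_iff_null_sets[symmetric]) auto
  then have "negligible (ball y r)"
    by (simp add: negligible_iff_null_sets null_sets_completionI)
  then show False
    using open_not_negligible[of "ball y r"] r(1) by auto
qed

lemma bump_lipschitz: "\<bar>bump y r x - bump y r z\<bar> \<le> 1 * norm (x - z)"
proof -
  have "\<bar>dist x y - dist z y\<bar> \<le> dist x z"
    by (metis abs_dist_diff_le dist_commute)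
  then show ?thesis by (auto simp: bump_def dist_norm max_def)
qed

lemma smooth_imp_twice_differentiable:
  assumes "smooth p"
  shows "twice_differentiable p"
proof -
  have "C_k (Suc (Suc 0)) p" using assms by (simp add: smooth_def)
  then show ?thesis by unfold_locales auto
qed

locale smooth_exponential_functional = exponential_functional M B \<mu> \<alpha> p + transported_density p "\<chi> i. \<alpha> i \<bullet> \<mu>"
  for M :: "'w measure" and B :: "real \<Rightarrow> 'w \<Rightarrow> real ^ 'n::finite" and \<mu> :: "real ^ 'n"
    and \<alpha> :: "'d::finite \<Rightarrow> real ^ 'n" and p
begin

text \<open>The substitution \<open>z = s\<^sup>2 + k y\<close> undoes the transport of \<open>p\<close>, and its Jacobian cancels \<open>J\<close>. In
  this form the integral is visibly bounded by the supremum of \<open>f\<close>.\<close>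

lemma perturbed_density_change_of_variables:
  assumes [measurable]: "f \<in> borel_measurable borel"
  shows "(\<integral>z. f z * q (\<chi> i. \<alpha> i \<bullet> g) 1 z s \<partial>lborel)
    = (\<integral>y. p y * f (\<chi> i. s\<^sup>2 + exp (- 2 * (\<alpha> i \<bullet> (s *\<^sub>R g + s\<^sup>2 *\<^sub>R \<mu>))) * y $ i) \<partial>lborel)"
proof -
  define k where "k i = exp (- 2 * (\<alpha> i \<bullet> (s *\<^sub>R g + s\<^sup>2 *\<^sub>R \<mu>)))" for i
  have expo: "expo (\<chi> i. \<alpha> i \<bullet> g) 1 i s = inverse (k i)" for i
    by (simp add: expo_def k_def inner_add_right flip: exp_minus)
  have k: "0 < k i" for i by (simp add: k_def)
  then have k0: "k i \<noteq> 0" for i by (metis less_irrefl)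
  let ?T = "\<lambda>y. \<chi> i. s\<^sup>2 + k i * y $ i"
  have u: "(\<chi> i. u (\<chi> i. \<alpha> i \<bullet> g) 1 (?T y) i s) = y" for y
    using k0 by (simp add: u_def expo vec_eq_iff)
  have J: "(\<Prod>i\<in>UNIV. k i) * J (\<chi> i. \<alpha> i \<bullet> g) 1 s = 1"
    using k0 by (simp add: J_def expo prod_inversef[symmetric] flip: prod.distrib)
  have [measurable]: "(\<lambda>z. q (\<chi> i. \<alpha> i \<bullet> g) 1 z s) \<in> borel_measurable borel"
  proof (rule borel_measurable_continuous_onI)
    show "continuous_on UNIV (\<lambda>z. q (\<chi> i. \<alpha> i \<bullet> g) 1 z s)"
      using continuous_on_compose2[OF continuous_on_q, of UNIV "\<lambda>z. (s, \<chi> i. \<alpha> i \<bullet> g, 1, z)"]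
      by (simp add: continuous_on_Pair continuous_on_const continuous_on_id)
  qed
  have "(\<integral>z. f z * q (\<chi> i. \<alpha> i \<bullet> g) 1 z s \<partial>lborel)
      = (\<Prod>i\<in>UNIV. k i) * (\<integral>y. f (?T y) * q (\<chi> i. \<alpha> i \<bullet> g) 1 (?T y) s \<partial>lborel)"
    by (subst lborel_integral_diagonal[where \<kappa>="\<chi> i. k i" and c="\<chi> i. s\<^sup>2"]) (use k in auto)
  also have "\<dots> = (\<integral>y. ((\<Prod>i\<in>UNIV. k i) * J (\<chi> i. \<alpha> i \<bullet> g) 1 s) * (p y * f (?T y)) \<partial>lborel)"
    unfolding q_def u integral_mult_right_zero[symmetric] by (simp add: mult_ac)
  finally show ?thesis unfolding J by (simp add: k_def)
qed

text \<open>Divided by \<open>s\<^sup>2\<close>, the difference of the two expectations tends to half the integral by the Taylor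
  expansion of the density, and to 0 by the renewal identity.\<close>

lemma adjoint_generator_orthogonal:
  fixes f :: "real ^ 'd \<Rightarrow> real"
  assumes K: "compact K" and fK: "\<And>z. z \<notin> K \<Longrightarrow> f z = 0"
    and lip: "\<And>x y. \<bar>f x - f y\<bar> \<le> H * norm (x - y)" and bd: "\<And>x. \<bar>f x\<bar> \<le> C"
    and cont: "continuous_on UNIV f"
  shows "(\<integral>z. f z * ((\<Sum>j\<in>UNIV. \<Sum>i\<in>UNIV. (\<alpha> i \<bullet> \<alpha> j) * quad_coeff z i j) + const_coeff z) \<partial>lborel) = 0"
    (is "?I = 0")
proof -
  have [measurable]: "f \<in> borel_measurable borel"
    using cont by (rule borel_measurable_continuous_onI)
  define F where "F g s = (\<integral>z. f z * q (\<chi> i. \<alpha> i \<bullet> g) 1 z s \<partial>lborel)" for g s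
  define G where "G s x = (\<integral>y. p y * f (\<chi> i. s\<^sup>2 + exp (- 2 * (\<alpha> i \<bullet> (x + s\<^sup>2 *\<^sub>R \<mu>))) * y $ i) \<partial>lborel)" for s x
  have FG: "F g s = G s (s *\<^sub>R g)" for g s
    unfolding F_def G_def by (rule perturbed_density_change_of_variables) simp
  have G_measurable: "G s \<in> borel_measurable borel" for s
  proof -
    have "continuous_on UNIV (\<lambda>z::(real^'n) \<times> (real^'d). f (\<chi> i. s\<^sup>2 + exp (- 2 * (\<alpha> i \<bullet> (fst z + s\<^sup>2 *\<^sub>R \<mu>))) * snd z $ i))"
      by (rule continuous_on_compose2[OF cont]) (auto intro!: continuous_intros continuous_on_vec_lambda)
    then have "(\<lambda>z::(real^'n) \<times> (real^'d). f (\<chi> i. s\<^sup>2 + exp (- 2 * (\<alpha> i \<bullet> (fst z + s\<^sup>2 *\<^sub>R \<mu>))) * snd z $ i))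
        \<in> borel_measurable (borel \<Otimes>\<^sub>M borel)"
      unfolding borel_prod by (rule borel_measurable_continuous_onI)
    then have [measurable]: "(\<lambda>z::(real^'n) \<times> (real^'d). f (\<chi> i. s\<^sup>2 + exp (- 2 * (\<alpha> i \<bullet> (fst z + s\<^sup>2 *\<^sub>R \<mu>))) * snd z $ i))
        \<in> borel_measurable (borel \<Otimes>\<^sub>M lborel)"
      by (subst measurable_cong_sets[OF sets_pair_measure_cong[OF refl sets_lborel] refl])
    have "(\<lambda>z. p (snd z) * f (\<chi> i. s\<^sup>2 + exp (- 2 * (\<alpha> i \<bullet> (fst z + s\<^sup>2 *\<^sub>R \<mu>))) * snd z $ i))
        \<in> borel_measurable (borel \<Otimes>\<^sub>M lborel)"
      by measurable
    then show ?thesis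
      unfolding G_def[abs_def] by (intro lborel.borel_measurable_lebesgue_integral) (simp add: split_def)
  qed
  have C: "0 \<le> C" using bd[of undefined] by linarith
  have pint: "integrable lborel p" "integral\<^sup>L lborel p = 1"
    using p_integral by (simp_all add: has_bochner_integral_iff)
  have p_mult: "\<bar>\<integral>y. p y * h y \<partial>lborel\<bar> \<le> C" if "\<And>y. \<bar>h y\<bar> \<le> C" for h
  proof -
    have "norm (\<integral>y. p y * h y \<partial>lborel) \<le> (\<integral>y. p y * C \<partial>lborel)"
    proof (cases "integrable lborel (\<lambda>y. p y * h y)")
      case True
      then show ?thesis
        using pint(1) that p_nonneg by (intro Bochner_Integration.integral_norm_bound_integral) (auto simp: abs_mult intro!: mult_left_mono)
    qed (use pint C in \<open>simp add: not_integrable_integral_eq\<close>)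
    then show ?thesis using pint by simp
  qed
  define s where "s n = 1 / real (Suc n)" for n
  have s: "0 < s n" "s n \<le> 1" for n by (simp_all add: s_def)
  have s_lim: "s \<longlonglongrightarrow> 0" unfolding s_def[abs_def] by (rule LIMSEQ_inverse_real_of_nat[unfolded inverse_eq_divide])
  have lim: "(\<lambda>n. ((\<integral>g. gauss 1 g * F g (s n) \<partial>lborel) - (\<integral>z. f z * p z \<partial>lborel)) / (s n)\<^sup>2) \<longlonglongrightarrow> ?I / 2"
    unfolding F_def
  proof (rule gaussian_average_limit[OF K cont fK s s_lim])
    show "\<bar>\<integral>z. f z * q (\<chi> i. \<alpha> i \<bullet> g) 1 z s \<partial>lborel\<bar> \<le> C" for s g
      unfolding perturbed_density_change_of_variables[OF borel_measurable_continuous_onI[OF cont]]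
      by (rule p_mult[OF bd])
  qed
  have "\<bar>?I / 2\<bar> \<le> e" if e: "0 < e" for e
  proof -
    obtain \<delta> where \<delta>: "0 < \<delta>" and est: "\<And>t. 0 < t \<Longrightarrow> t \<le> \<delta> \<Longrightarrow>
      \<bar>(\<integral>x. gauss t x * (\<integral>y. p y * f (\<chi> i. t + exp (- 2 * (\<alpha> i \<bullet> (x + t *\<^sub>R \<mu>))) * y $ i) \<partial>lborel) \<partial>lborel)
      - (\<integral>y. p y * f y \<partial>lborel)\<bar> \<le> e * t"
      using short_time_estimate[OF lip bd e] by auto
    have "(\<lambda>n. (s n)\<^sup>2) \<longlonglongrightarrow> 0\<^sup>2" by (intro tendsto_intros s_lim)
    then have "eventually (\<lambda>n. (s n)\<^sup>2 < \<delta>) sequentially"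
      using \<delta> by (intro order_tendstoD) auto
    then have "eventually (\<lambda>n. \<bar>((\<integral>g. gauss 1 g * F g (s n) \<partial>lborel) - (\<integral>z. f z * p z \<partial>lborel)) / (s n)\<^sup>2\<bar> \<le> e) sequentially"
    proof eventually_elim
      case (elim n)
      have "(\<integral>g. gauss 1 g * F g (s n) \<partial>lborel) = (\<integral>x. gauss ((s n)\<^sup>2) x * G (s n) x \<partial>lborel)"
        unfolding FG by (rule gauss_scale[OF s(1) G_measurable, symmetric])
      then have "\<bar>(\<integral>g. gauss 1 g * F g (s n) \<partial>lborel) - (\<integral>z. f z * p z \<partial>lborel)\<bar> \<le> e * (s n)\<^sup>2"
        using est[of "(s n)\<^sup>2"] elim s(1)[of n] by (simp add: G_def mult.commute[of "f _"])
      then show ?case using s(1)[of n] by (simp add: divide_le_eq)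
    qed
    then show ?thesis
      using tendsto_upperbound[OF tendsto_rabs[OF lim]] by simp
  qed
  \<comment> \<open>A positive \<open>\<bar>?I\<bar> / 2\<close> would exceed \<open>\<bar>?I\<bar> / 4\<close>.\<close>
  from this[of "\<bar>?I\<bar> / 4"] show ?thesis by fastforce
qed

lemma adjoint_generator_zero:
  "(\<Sum>j\<in>UNIV. \<Sum>i\<in>UNIV. (\<alpha> i \<bullet> \<alpha> j) * quad_coeff y i j) + const_coeff y = 0"
proof (rule continuous_eq_zero_if_orthogonal_to_bumps)
  have "continuous_on UNIV (\<lambda>z. quad_coeff z i j)" for i j
    unfolding quad_coeff_def by (cases "i = j") (auto intro!: continuous_intros p_cont dp_cont ddp_cont)
  moreover have "continuous_on UNIV const_coeff"
    unfolding const_coeff_def[abs_def] by (auto intro!: continuous_intros p_cont dp_cont ddp_cont)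
  ultimately show "continuous_on UNIV (\<lambda>y. (\<Sum>j\<in>UNIV. \<Sum>i\<in>UNIV. (\<alpha> i \<bullet> \<alpha> j) * quad_coeff y i j) + const_coeff y)"
    by (intro continuous_intros)
  fix r :: real assume "0 < r"
  show "(\<integral>z. bump y r z * ((\<Sum>j\<in>UNIV. \<Sum>i\<in>UNIV. (\<alpha> i \<bullet> \<alpha> j) * quad_coeff z i j) + const_coeff z) \<partial>lborel) = 0"
  proof (rule adjoint_generator_orthogonal[OF compact_cball[of y r] _ bump_lipschitz])
    show "bump y r z = 0" if "z \<notin> cball y r" for z
      using that by (simp add: bump_def dist_commute)
    show "\<bar>bump y r z\<bar> \<le> r" for z
      using \<open>0 < r\<close> by (simp add: bump_def)
    show "continuous_on UNIV (bump y r)"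
      unfolding bump_def[abs_def] by (intro continuous_intros)
  qed
qed

end

theorem mainTheorem2:
  fixes M :: "'w measure"
    and \<alpha> :: "'d::finite \<Rightarrow> real ^ 'n::finite"
    and \<mu> :: "real ^ 'n"
    and B :: "real \<Rightarrow> 'w \<Rightarrow> real ^ 'n"
    and p :: "real ^ 'd \<Rightarrow> real"
    and y :: "real ^ 'd"
  assumes "inj \<alpha>" and "\<forall>i. \<alpha> i \<noteq> 0"
    and "\<mu> \<in> Omega \<alpha>"
    and "brownian_motion_with_drift M \<mu> B"
    and "smooth_density M (A_infinity \<alpha> B) p"
    and "\<forall>i. 0 < y $ i"
  shows "(\<Sum>i\<in>UNIV. \<Sum>j\<in>UNIV. (\<alpha> i \<bullet> \<alpha> j) * y $ i * y $ j * partial i (partial j p) y)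
       + (\<Sum>i\<in>UNIV. ((\<alpha> i \<bullet> \<mu> + (norm (\<alpha> i))\<^sup>2 + 2 * (\<Sum>j\<in>UNIV. \<alpha> i \<bullet> \<alpha> j)) * y $ i - 1 / 2)
            * partial i p y)
       = - ((\<Sum>i\<in>UNIV. \<Sum>j\<in>UNIV. \<alpha> i \<bullet> \<alpha> j) + (\<Sum>i\<in>UNIV. \<alpha> i \<bullet> \<mu>)) * p y"
proof -
  have sd: "smooth p" "\<And>y. 0 \<le> p y" "distributed M lborel (A_infinity \<alpha> B) (\<lambda>y. ennreal (p y))"
    using assms(5) by (auto simp: smooth_density_def)
  interpret twice_differentiable p
    by (rule smooth_imp_twice_differentiable[OF sd(1)])
  interpret smooth_exponential_functional M B \<mu> \<alpha> p
    by unfold_locales (use assms(4) sd in auto)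
  have quad_coeff_sum: "(\<Sum>j\<in>UNIV. \<Sum>i\<in>UNIV. (\<alpha> i \<bullet> \<alpha> j) * quad_coeff y i j) =
     4 * ((\<Sum>i\<in>UNIV. \<Sum>j\<in>UNIV. (\<alpha> i \<bullet> \<alpha> j) * y $ i * y $ j * partial i (partial j p) y)
       + (\<Sum>j\<in>UNIV. (norm (\<alpha> j))\<^sup>2 * y $ j * partial j p y)
       + (\<Sum>j\<in>UNIV. 2 * (\<Sum>i\<in>UNIV. \<alpha> j \<bullet> \<alpha> i) * y $ j * partial j p y)
       + (\<Sum>i\<in>UNIV. \<Sum>j\<in>UNIV. \<alpha> i \<bullet> \<alpha> j) * p y)"
  proof -
    have split: "(\<alpha> i \<bullet> \<alpha> j) * quad_coeff y i j =
      4 * ((\<alpha> i \<bullet> \<alpha> j) * y $ i * y $ j * partial i (partial j p) y)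
      + 4 * (if i = j then (\<alpha> i \<bullet> \<alpha> j) * (y $ j * partial j p y) else 0)
      + 4 * (2 * (\<alpha> j \<bullet> \<alpha> i) * y $ j * partial j p y)
      + 4 * ((\<alpha> i \<bullet> \<alpha> j) * p y)" for i j
      by (simp add: quad_coeff_def algebra_simps inner_commute[of "\<alpha> j" "\<alpha> i"])
    have "(\<Sum>j\<in>UNIV. \<Sum>i\<in>UNIV. (\<alpha> i \<bullet> \<alpha> j) * quad_coeff y i j) =
      4 * (\<Sum>j\<in>UNIV. \<Sum>i\<in>UNIV. (\<alpha> i \<bullet> \<alpha> j) * y $ i * y $ j * partial i (partial j p) y)
      + 4 * (\<Sum>j\<in>UNIV. (\<alpha> j \<bullet> \<alpha> j) * (y $ j * partial j p y))
      + 4 * (\<Sum>j\<in>UNIV. 2 * (\<Sum>i\<in>UNIV. \<alpha> j \<bullet> \<alpha> i) * y $ j * partial j p y)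
      + 4 * ((\<Sum>j\<in>UNIV. \<Sum>i\<in>UNIV. \<alpha> i \<bullet> \<alpha> j) * p y)"
      unfolding split sum.distrib sum_distrib_left[symmetric]
      by (simp add: sum_distrib_right sum_distrib_left mult_ac)
    moreover have "(\<Sum>j\<in>UNIV. \<Sum>i\<in>UNIV. (\<alpha> i \<bullet> \<alpha> j) * y $ i * y $ j * partial i (partial j p) y)
      = (\<Sum>i\<in>UNIV. \<Sum>j\<in>UNIV. (\<alpha> i \<bullet> \<alpha> j) * y $ i * y $ j * partial i (partial j p) y)"
      "(\<Sum>j\<in>UNIV. \<Sum>i\<in>UNIV. \<alpha> i \<bullet> \<alpha> j) = (\<Sum>i\<in>UNIV. \<Sum>j\<in>UNIV. \<alpha> i \<bullet> \<alpha> j)"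
      by (rule sum.swap)+
    ultimately show ?thesis
      by (simp add: dot_square_norm mult_ac)
  qed
  have const_coeff_sum: "const_coeff y = 4 * ((\<Sum>i\<in>UNIV. (\<alpha> i \<bullet> \<mu>) * y $ i * partial i p y)
      - (\<Sum>i\<in>UNIV. 1 / 2 * partial i p y) + (\<Sum>i\<in>UNIV. \<alpha> i \<bullet> \<mu>) * p y)"
  proof -
    have "partial i p y * (4 * (\<chi> i. \<alpha> i \<bullet> \<mu>) $ i * y $ i - 2) =
       4 * ((\<alpha> i \<bullet> \<mu>) * y $ i * partial i p y) - 4 * (1 / 2 * partial i p y)" for i
      by (simp add: algebra_simps)
    then show ?thesis
      by (simp only: const_coeff_def sum_subtractf sum_distrib_left[symmetric]) (simp add: algebra_simps)
  qed
  have first_order: "(\<Sum>i\<in>UNIV. ((\<alpha> i \<bullet> \<mu> + (norm (\<alpha> i))\<^sup>2 + 2 * (\<Sum>j\<in>UNIV. \<alpha> i \<bullet> \<alpha> j)) * y $ i - 1 / 2) * partial i p y)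
     = (\<Sum>i\<in>UNIV. (\<alpha> i \<bullet> \<mu>) * y $ i * partial i p y) + (\<Sum>i\<in>UNIV. (norm (\<alpha> i))\<^sup>2 * y $ i * partial i p y)
       + (\<Sum>i\<in>UNIV. 2 * (\<Sum>j\<in>UNIV. \<alpha> i \<bullet> \<alpha> j) * y $ i * partial i p y) - (\<Sum>i\<in>UNIV. 1 / 2 * partial i p y)"
    unfolding sum.distrib[symmetric] sum_subtractf[symmetric]
    by (intro sum.cong refl) (simp only: distrib_right left_diff_distrib)
  \<comment> \<open>The common factor 4 stems from the exponents \<open>- 2 \<alpha>\<^sub>i\<close>.\<close>
  have rearrange: "a + (e + b + c - f) = - (d + g)" if "4 * (a + b + c + d) + 4 * (e - f + g) = 0"
    for a b c d e f g :: real
    using that by simp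
  show ?thesis
    using rearrange[OF adjoint_generator_zero[of y, unfolded quad_coeff_sum const_coeff_sum]]
    unfolding first_order by (simp only: minus_mult_left[symmetric] distrib_right)
qed

end
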